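(* Let $n\ge 3$ be odd. Every valid configuration $(\sigma,\tau_s,\tau_{c_i},\rho_{c_i},\rho_{e_{i,j}},x,y_i,z)$ of the $n\times n\times n$ Rubik's Cube satisfies: (1) $\operatorname{sgn}(\sigma)=\operatorname{sgn}(\tau_s)=\operatorname{sgn}(\rho_{c_i})$ for every center corner orbit $i$; (2) $\operatorname{sgn}(\rho_{e_{i,j}})=\operatorname{sgn}(\sigma)\operatorname{sgn}(\tau_i)\operatorname{sgn}(\tau_j)$ for every center edge orbit $(i,j)$, where $\tau_k$ denotes $\tau_{c_k}$ and $\operatorname{sgn}(\tau_{(n+1)/2})$ is interpreted as $1$; (3) $\sum_{k=1}^8 x_k=0$ in $\mathbb{Z}_3$; (4) $\sum_{k=1}^{12} z_k=0$ in $\mathbb{Z}_2$; (5) $y_i=0$ for every coupled edge orbit $i$.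
   Context: Cube and moves: the $n\times n\times n$ Rubik's Cube has faces U, D, F, B, R, L, each an $n\times n$ grid of facelets carrying stickers; in the solved state each face is monochromatic with six distinct colors. For $1\le k\le\lfloor n/2\rfloor$, $F_k,B_k,R_k,L_k,U_k,D_k$ denote clockwise (seen from the named face) $90^\circ$ rotations of the $k$-th slice counted from the named face ($k=1$: face turns; $k>1$: internal slice rotations). A configuration is valid if it is obtained from the solved state by a sequence of these moves. Cubie types ($n$ odd): 8 corners (3 stickers); along each of the 12 edges lie edge cubies at positions $2,\dots,n-1$; the one at position $(n+1)/2$ is a single edge (12 total); for $2\le i\le (n-1)/2$ the 24 edge cubies at positions $i$ and $n+1-i$ form coupled edge orbit $i$. On each face index facelets $(r,c)$, $1\le r,c\le n$; for $2\le i\le (n-1)/2$ the center corner orbit $i$ is the 24 facelets with $r,c\in\{i,n+1-i\}$; for $2\le i\le (n-1)/2$, $2\le j\le (n+1)/2$, $j\ne i$, the center edge orbit $(i,j)$ is the 24 facelets occupying on each face the positions $(i,j),(j,n+1-i),(n+1-i,n+1-j),(n+1-j,i)$. Coordinates of a configuration: $\sigma\in S_8$ (permutation of corner cubies), $\tau_s\in S_{12}$ (single edges), $\tau_{c_i}\in S_{24}$ (coupled edges of orbit $i$), $\rho_{c_i}\in S_{24}$ (center corners of orbit $i$), $\rho_{e_{i,j}}\in S_{24}$ (center edges of orbit $(i,j)$), $x\in\mathbb{Z}_3^8$ (corner orientations), $y_i\in\mathbb{Z}_2^{24}$ (coupled edge orientations in orbit $i$), $z\in\mathbb{Z}_2^{12}$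 (single edge orientations); the solved state has identity permutations and zero orientations. Orientations: for corners, each corner cubie has exactly one sticker of the color of the (solved) white or yellow face, a designated pair of opposite faces; its orientation is $0$ if that sticker lies on the white or yellow face, $1$ if the cubie is rotated one step clockwise from orientation $0$, $2$ if two steps. For single edges, one of the two facelets of each single-edge position is fixed as reference facelet (a fixed choice for which all single edges have orientation 0 in the solved state); $z_k=0$ iff the sticker of the cubie at position $k$ that lay on a reference facelet in the solved state lies on a reference facelet. For coupled edges, call a coupled-edge facelet on face $X$ along the edge shared with face $Y$ left-handed if, viewing face $X$ from outside with that edge at the top, it lies left of the edge's midpoint; $y_{i,k}=0$ iff the sticker of the cubie at position $k$ of orbit $i$ that lay on a left-handed facelet in the solved state lies on a left-handed facelet. $\operatorname{sgn}$ is the sign of a permutation. *)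

theory Defs
  imports
    "HOL-Library.Product_Plus"
    "HOL-Combinatorics.Permutations"
    "HOL-Combinatorics.Orbits"
    "HOL-Number_Theory.Cong"
begin

text \<open>
  The cube is centred at the origin of \<open>\<int>\<^sup>3\<close>, with the first axis pointing to the right face, the
  second to the upper face and the third to the front face (a right-handed frame). Lengths are
  doubled: the cubie in the layers \<open>a, b, c \<in> {1..n}\<close> has centre \<open>(2a-n-1, 2b-n-1, 2c-n-1)\<close>, so
  that the outer layers have coordinate \<open>\<plusminus>(n-1)\<close>.
\<close>

type_synonym vec = "int \<times> int \<times> int"

fun dot :: "vec \<Rightarrow> vec \<Rightarrow> int" where
  "dot (a, b, c) (a', b', c') = a * a' + b * b' + c * c'"

fun cross :: "vec \<Rightarrow> vec \<Rightarrow> vec" where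
  "cross (a, b, c) (a', b', c') = (b * c' - c * b', c * a' - a * c', a * b' - b * a')"

fun scale :: "int \<Rightarrow> vec \<Rightarrow> vec" where
  "scale t (a, b, c) = (t * a, t * b, t * c)"

datatype face = Up | Down | Front | Back | Right | Left

fun normal :: "face \<Rightarrow> vec" where
  "normal Right = (1, 0, 0)"
| "normal Left = (-1, 0, 0)"
| "normal Up = (0, 1, 0)"
| "normal Down = (0, -1, 0)"
| "normal Front = (0, 0, 1)"
| "normal Back = (0, 0, -1)"

text \<open>A facelet is given by the centre of its cubie and the outward normal of its face.\<close>

type_synonym facelet = "vec \<times> vec"

text \<open>
  Row \<open>r\<close> (counted from the top) and column \<open>c\<close> (counted from the left) of face \<open>X\<close> viewed from
  outside, where \<open>face_top X\<close> is the adjacent face that is held at the top. The orbits below do not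
  depend on the choice of \<open>face_top\<close>.
\<close>

fun face_top :: "face \<Rightarrow> face" where
  "face_top Up = Back"
| "face_top Down = Front"
| "face_top Front = Up"
| "face_top Back = Up"
| "face_top Right = Up"
| "face_top Left = Up"

definition facelet_at :: "nat \<Rightarrow> face \<Rightarrow> nat \<Rightarrow> nat \<Rightarrow> facelet" where
  "facelet_at n X r c =
    (scale (int n - 1) (normal X)
       + scale (2 * int c - int n - 1) (cross (normal (face_top X)) (normal X))
       - scale (2 * int r - int n - 1) (normal (face_top X)),
     normal X)"

definition facelets :: "nat \<Rightarrow> facelet set" where
  "facelets n = {facelet_at n X r c | X r c. r \<in> {1..n} \<and> c \<in> {1..n}}"

text \<open>Rotation by 90 degrees about the normal of \<open>X\<close>, clockwise as seen from outside face \<open>X\<close>.\<close>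

definition rot_cw :: "face \<Rightarrow> vec \<Rightarrow> vec" where
  "rot_cw X v = scale (dot v (normal X)) (normal X) + cross v (normal X)"

definition turn :: "nat \<Rightarrow> face \<Rightarrow> nat \<Rightarrow> facelet \<Rightarrow> facelet" where
  "turn n X k f =
    (if f \<in> facelets n \<and> dot (fst f) (normal X) = int n + 1 - 2 * int k
     then (rot_cw X (fst f), rot_cw X (snd f)) else f)"

text \<open>
  Stickers are named by the facelets that carry them in the solved state; a configuration \<open>s\<close> maps
  every facelet to the sticker that it carries. Thus the facelet \<open>turn n X k f\<close> carries after the
  move the sticker that \<open>f\<close> carried before.
\<close>

type_synonym config = "facelet \<Rightarrow> facelet"

inductive valid_config :: "nat \<Rightarrow> config \<Rightarrow> bool" for n :: nat where
  solved: "valid_config n id"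
| move: "valid_config n s \<Longrightarrow> 1 \<le> k \<Longrightarrow> k \<le> n div 2 \<Longrightarrow> valid_config n (s \<circ> inv (turn n X k))"

text \<open>
  The cubie occupying position \<open>p\<close>, named by its position in the solved state.
\<close>

definition cubie_at :: "nat \<Rightarrow> config \<Rightarrow> vec \<Rightarrow> vec" where
  "cubie_at n s p = (THE q. \<forall>d. (p, d) \<in> facelets n \<longrightarrow> fst (s (p, d)) = q)"

definition corners :: "nat \<Rightarrow> vec set" where
  "corners n = (let S = {- (int n - 1), int n - 1} in S \<times> S \<times> S)"

text \<open>
  The edge cubies at positions \<open>t\<close> and \<open>n+1-t\<close> along the 12 edges: the ordered pairs \<open>(X, Y)\<close> and
  \<open>(Y, X)\<close> give the same edge, run through in opposite directions.
\<close>

definition edge_cubies :: "nat \<Rightarrow> nat \<Rightarrow> vec set" where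
  "edge_cubies n t =
    {scale (int n - 1) (normal X + normal Y)
       + scale (2 * int t - int n - 1) (cross (normal X) (normal Y))
     | X Y. dot (normal X) (normal Y) = 0}"

definition single_edges :: "nat \<Rightarrow> vec set" where
  "single_edges n = edge_cubies n ((n + 1) div 2)"

definition center_corner_orbit :: "nat \<Rightarrow> nat \<Rightarrow> facelet set" where
  "center_corner_orbit n i = {facelet_at n X r c | X r c. r \<in> {i, n + 1 - i} \<and> c \<in> {i, n + 1 - i}}"

definition center_edge_orbit :: "nat \<Rightarrow> nat \<Rightarrow> nat \<Rightarrow> facelet set" where
  "center_edge_orbit n i j =
    {facelet_at n X r c | X r c.
       (r, c) \<in> {(i, j), (j, n + 1 - i), (n + 1 - i, n + 1 - j), (n + 1 - j, i)}}"

definition corner_perm :: "nat \<Rightarrow> config \<Rightarrow> vec \<Rightarrow> vec" where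
  "corner_perm n s = perm_restrict (cubie_at n s) (corners n)"

definition single_edge_perm :: "nat \<Rightarrow> config \<Rightarrow> vec \<Rightarrow> vec" where
  "single_edge_perm n s = perm_restrict (cubie_at n s) (single_edges n)"

definition coupled_edge_perm :: "nat \<Rightarrow> nat \<Rightarrow> config \<Rightarrow> vec \<Rightarrow> vec" where
  "coupled_edge_perm n i s = perm_restrict (cubie_at n s) (edge_cubies n i)"

definition center_corner_perm :: "nat \<Rightarrow> nat \<Rightarrow> config \<Rightarrow> facelet \<Rightarrow> facelet" where
  "center_corner_perm n i s = perm_restrict s (center_corner_orbit n i)"

definition center_edge_perm :: "nat \<Rightarrow> nat \<Rightarrow> nat \<Rightarrow> config \<Rightarrow> facelet \<Rightarrow> facelet" where
  "center_edge_perm n i j s = perm_restrict s (center_edge_orbit n i j)"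

text \<open>
  \<open>W\<close> is the white face, the opposite face is the yellow one. Read as a sticker, \<open>f\<close> satisfies
  \<open>white_yellow W f\<close> iff its color is white or yellow; read as a facelet, iff it lies on the white
  or yellow face.
\<close>

definition white_yellow :: "face \<Rightarrow> facelet \<Rightarrow> bool" where
  "white_yellow W f \<longleftrightarrow> snd f \<in> {normal W, - normal W}"

text \<open>
  At the corner position \<open>p\<close>, \<open>d\<close> is the direction in which the white or yellow sticker points and
  \<open>e\<close> the one in which it would point at orientation 0. The negative triple product says that a
  third of a turn about the outward diagonal \<open>p\<close>, clockwise as seen from outside, takes \<open>e\<close> to \<open>d\<close>.
\<close>

definition corner_orientation :: "nat \<Rightarrow> face \<Rightarrow> config \<Rightarrow> vec \<Rightarrow> nat" where
  "corner_orientation n W s p =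
    (let d = (THE d. (p, d) \<in> facelets n \<and> white_yellow W (s (p, d)));
         e = (THE e. (p, e) \<in> facelets n \<and> white_yellow W (p, e))
     in if d = e then 0 else if dot p (cross e d) < 0 then 1 else 2)"

text \<open>
  Orientation of the edge cubie at position \<open>p\<close> relative to a set \<open>Ref\<close> that contains one of the
  two facelets of every position in question: it is 0 iff the sticker of the cubie that lay on a
  facelet in \<open>Ref\<close> in the solved state lies on a facelet in \<open>Ref\<close>.
\<close>

definition edge_orientation :: "facelet set \<Rightarrow> config \<Rightarrow> vec \<Rightarrow> nat" where
  "edge_orientation Ref s p = (if \<exists>f \<in> Ref. fst f = p \<and> s f \<in> Ref then 0 else 1)"

definition single_edge_reference :: "nat \<Rightarrow> facelet set \<Rightarrow> bool" where
  "single_edge_reference n Ref \<longleftrightarrow>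
    Ref \<subseteq> {f \<in> facelets n. fst f \<in> single_edges n} \<and>
    (\<forall>p \<in> single_edges n. \<exists>!f. f \<in> Ref \<and> fst f = p)"

text \<open>
  Viewing face \<open>X\<close> from outside with the edge shared with \<open>Y\<close> at the top, the vector
  \<open>cross (normal Y) (normal X)\<close> points to the right.
\<close>

definition left_handed_facelets :: "nat \<Rightarrow> nat \<Rightarrow> facelet set" where
  "left_handed_facelets n i =
    {(p, normal X) | p X Y. p \<in> edge_cubies n i \<and>
       (p, normal X) \<in> facelets n \<and> (p, normal Y) \<in> facelets n \<and>
       dot p (cross (normal Y) (normal X)) < 0}"

definition single_edge_orientation :: "facelet set \<Rightarrow> config \<Rightarrow> vec \<Rightarrow> nat" where
  "single_edge_orientation Ref s p = edge_orientation Ref s p"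

definition coupled_edge_orientation :: "nat \<Rightarrow> nat \<Rightarrow> config \<Rightarrow> vec \<Rightarrow> nat" where
  "coupled_edge_orientation n i s p = edge_orientation (left_handed_facelets n i) s p"

end

theory Submission
  imports Defs
begin

text \<open>
  The inverse of a turn is its third power, so every valid configuration is a product of turns, and
  it suffices to see how each coordinate changes under one turn. A turn acts on every orbit by
  4-cycles only, so its sign on an orbit is \<open>(-1)\<^sup>r\<close> where \<open>4r\<close> is the number of elements of the
  orbit in the turned slice; comparing these numbers gives the sign identities. Corner and single
  edge orientations are differences of a potential on facelets modulo 3 and 2. They do not depend on
  which facelet of a cubie they are read off, and reading them off the turned face shows that
  the total is unchanged. Left-handedness of coupled edge facelets is expressed by a triple product
  and hence preserved by rotations.
\<close>

section \<open>Rotations, facelets and turns\<close>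

text \<open>A potential counts steps from a reference facelet at the same position, and a rotation
  need not carry reference facelets to reference facelets. Only the difference between two facelets
  of one cubie is rotation-invariant. This suffices for totals: at positions in the turned slice the
  total may be read on the face \<open>X\<close> being turned, whose normal the rotation fixes, so
  the chosen facelets are permuted among themselves and the sum is merely reindexed. For this, every
  corner and single edge in a turned slice must have a facelet on that face. It does, because moves
  turn only layers with positive coordinate towards \<open>X\<close>, whereas corners and single
  edges have no coordinates other than \<open>n-1\<close>, \<open>0\<close> and \<open>1-n\<close>.
  All cycles have length 4 because no element of the orbits considered lies on a rotation axis, so
  that even a half turn moves it.\<close>

lemma rot_cw_simps [simp]:
  "rot_cw Right (a, b, c) = (a, c, - b)"
  "rot_cw Left (a, b, c) = (a, - c, b)"
  "rot_cw Up (a, b, c) = (- c, b, a)"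
  "rot_cw Down (a, b, c) = (c, b, - a)"
  "rot_cw Front (a, b, c) = (b, - a, c)"
  "rot_cw Back (a, b, c) = (- b, a, c)"
  by (simp_all add: rot_cw_def)

lemma rot_cw_rot_cw_rot_cw_rot_cw [simp]: "rot_cw X (rot_cw X (rot_cw X (rot_cw X p))) = p"
  by (cases X; cases p) auto

lemma rot_cw_inject [simp]: "rot_cw X p = rot_cw X q \<longleftrightarrow> p = q"
  by (metis rot_cw_rot_cw_rot_cw_rot_cw)

lemma dot_rot_cw [simp]: "dot (rot_cw X p) (rot_cw X q) = dot p q"
  by (cases X; cases p; cases q) auto

lemma cross_rot_cw [simp]: "cross (rot_cw X p) (rot_cw X q) = rot_cw X (cross p q)"
  by (cases X; cases p; cases q) auto

lemma rot_cw_normal_self [simp]: "rot_cw X (normal X) = normal X"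
  by (cases X) auto

lemma dot_rot_cw_normal [simp]: "dot (rot_cw X p) (normal X) = dot p (normal X)"
  by (metis dot_rot_cw rot_cw_normal_self)

lemma UNIV_face: "UNIV = {Up, Down, Front, Back, Right, Left}"
  using face.exhaust by auto

lemma range_normal:
  "range normal = {(1, 0, 0), (-1, 0, 0), (0, 1, 0), (0, -1, 0), (0, 0, 1), (0, 0, -1)}"
  unfolding UNIV_face by auto

lemma rot_cw_range_normal: "d \<in> range normal \<Longrightarrow> rot_cw X d \<in> range normal"
  unfolding range_normal by (cases X) auto

text \<open>These are the numbers \<open>2r-n-1\<close> with \<open>r\<close> in
  \<open>{1..n}\<close>, described by size and parity so that closure under negation, and hence
  under rotations, is immediate.\<close>

definition layer_coords :: "nat \<Rightarrow> int set" where
  "layer_coords n = {x. \<bar>x\<bar> \<le> int n - 1 \<and> odd (x + int n)}"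

lemma uminus_layer_coords [simp]: "- x \<in> layer_coords n \<longleftrightarrow> x \<in> layer_coords n"
  by (auto simp: layer_coords_def)

lemma layer_coords_index:
  assumes "x \<in> layer_coords n"
  obtains r where "r \<in> {1..n}" "x = 2 * int r - int n - 1"
proof -
  obtain t where t: "x + int n = 2 * t + 1"
    using assms oddE[of "x + int n"] unfolding layer_coords_def by blast
  have "nat (t + 1) \<in> {1..n}" "x = 2 * int (nat (t + 1)) - int n - 1"
    using t assms by (auto simp: layer_coords_def)
  then show thesis by (rule that)
qed

lemma layer_coords_index_neg:
  assumes "x \<in> layer_coords n"
  obtains r where "r \<in> {1..n}" "x = - (2 * int r - int n - 1)"
  using layer_coords_index[of "- x" n] assms by (metis minus_minus uminus_layer_coords)

lemma index_in_layer_coords: "r \<in> {1..n} \<Longrightarrow> 2 * int r - int n - 1 \<in> layer_coords n"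
  by (auto simp: layer_coords_def)

text \<open>Rows and columns depend on \<open>face_top\<close> and behave badly under rotations.
  This description avoids them: each of its three conditions is preserved by rotations.\<close>

lemma facelets_iff:
  "(p, d) \<in> facelets n \<longleftrightarrow>
   d \<in> range normal \<and> dot p d = int n - 1 \<and>
   p \<in> layer_coords n \<times> layer_coords n \<times> layer_coords n"
  (is "?L \<longleftrightarrow> ?R")
proof
  assume ?L
  then obtain X r c where f: "(p, d) = facelet_at n X r c" and r: "r \<in> {1..n}" "c \<in> {1..n}"
    by (auto simp: facelets_def)
  have "int n - 1 \<in> layer_coords n"
    using r by (auto simp: layer_coords_def)
  moreover have "1 - int n \<in> layer_coords n"
    using calculation uminus_layer_coords[of "int n - 1" n] by simp
  moreover have "2 * int r - int n - 1 \<in> layer_coords n" "2 * int c - int n - 1 \<in> layer_coords n"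
    using r index_in_layer_coords by blast+
  moreover have "1 + int n - 2 * int r \<in> layer_coords n" "1 + int n - 2 * int c \<in> layer_coords n"
    using calculation(3,4) uminus_layer_coords[of "2 * int r - int n - 1" n]
      uminus_layer_coords[of "2 * int c - int n - 1" n] by (simp_all add: algebra_simps)
  ultimately show ?R
    using f by (cases X) (auto simp: facelet_at_def range_normal algebra_simps)
next
  assume R: ?R
  obtain x y z where p: "p = (x, y, z)" by (cases p)
  from R obtain X where X: "d = normal X" by auto
  have xyz: "x \<in> layer_coords n" "y \<in> layer_coords n" "z \<in> layer_coords n"
    using R p by auto
  obtain rx ry rz where r: "rx \<in> {1..n}" "x = 2 * int rx - int n - 1"
    "ry \<in> {1..n}" "y = 2 * int ry - int n - 1" "rz \<in> {1..n}" "z = 2 * int rz - int n - 1"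
    using layer_coords_index xyz by metis
  \<comment> \<open>Depending on the face, rows and columns run along an axis upwards (indices
    \<open>r\<close>) or downwards (indices \<open>s\<close>), so both indexings are needed.\<close>
  obtain sx sy sz where s: "sx \<in> {1..n}" "x = - (2 * int sx - int n - 1)"
    "sy \<in> {1..n}" "y = - (2 * int sy - int n - 1)" "sz \<in> {1..n}" "z = - (2 * int sz - int n - 1)"
    using layer_coords_index_neg xyz by metis
  have "\<exists>r c. (p, d) = facelet_at n X r c \<and> r \<in> {1..n} \<and> c \<in> {1..n}"
  proof (cases X)
    case Up
    show ?thesis using R p X Up r(1,2) r(5,6)
      by (intro exI[of _ rz] exI[of _ rx]) (auto simp: facelet_at_def)
  next
    case Down
    show ?thesis using R p X Down r(1,2) s(5,6)
      by (intro exI[of _ sz] exI[of _ rx]) (auto simp: facelet_at_def)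
  next
    case Front
    show ?thesis using R p X Front r(1,2) s(3,4)
      by (intro exI[of _ sy] exI[of _ rx]) (auto simp: facelet_at_def)
  next
    case Back
    show ?thesis using R p X Back s(1,2) s(3,4)
      by (intro exI[of _ sy] exI[of _ sx]) (auto simp: facelet_at_def)
  next
    case Right
    show ?thesis using R p X Right s(5,6) s(3,4)
      by (intro exI[of _ sy] exI[of _ sz]) (auto simp: facelet_at_def)
  next
    case Left
    show ?thesis using R p X Left r(5,6) s(3,4)
      by (intro exI[of _ sy] exI[of _ rz]) (auto simp: facelet_at_def)
  qed
  then show ?L by (auto simp: facelets_def)
qed

definition rot_facelet :: "face \<Rightarrow> facelet \<Rightarrow> facelet" where
  "rot_facelet X = map_prod (rot_cw X) (rot_cw X)"

lemma rot_facelet_simps [simp]: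
  "rot_facelet X (p, d) = (rot_cw X p, rot_cw X d)"
  "fst (rot_facelet X f) = rot_cw X (fst f)"
  "snd (rot_facelet X f) = rot_cw X (snd f)"
  by (simp_all add: rot_facelet_def)

lemma rot_facelet_rot_facelet_rot_facelet_rot_facelet [simp]:
  "rot_facelet X (rot_facelet X (rot_facelet X (rot_facelet X f))) = f"
  by (simp add: prod_eq_iff)

lemma rot_facelet_in_facelets: "f \<in> facelets n \<Longrightarrow> rot_facelet X f \<in> facelets n"
  by (cases f) (auto simp: facelets_iff rot_cw_range_normal, (cases X; simp)+)

definition slice :: "nat \<Rightarrow> face \<Rightarrow> nat \<Rightarrow> vec set" where
  "slice n X k = {p. dot p (normal X) = int n + 1 - 2 * int k}"

lemma rot_cw_in_slice [simp]: "rot_cw X p \<in> slice n X k \<longleftrightarrow> p \<in> slice n X k"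
  by (simp add: slice_def)

definition position_turn :: "nat \<Rightarrow> face \<Rightarrow> nat \<Rightarrow> vec \<Rightarrow> vec" where
  "position_turn n X k p = (if p \<in> slice n X k then rot_cw X p else p)"

lemma turn_eq:
  "turn n X k f =
   (if f \<in> facelets n \<and> fst f \<in> slice n X k then rot_facelet X f else f)"
  by (simp add: turn_def slice_def rot_facelet_def map_prod_def split: prod.split)

lemma turn_in_facelets: "f \<in> facelets n \<Longrightarrow> turn n X k f \<in> facelets n"
  by (simp add: turn_eq rot_facelet_in_facelets)

lemma fst_turn: "f \<in> facelets n \<Longrightarrow> fst (turn n X k f) = position_turn n X k (fst f)"
  by (simp add: turn_eq position_turn_def)

lemma turn_turn_turn_turn: "turn n X k (turn n X k (turn n X k (turn n X k f))) = f"
  by (cases "f \<in> facelets n \<and> fst f \<in> slice n X k")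
    (auto simp: turn_eq rot_facelet_in_facelets)

lemma inv_turn: "inv (turn n X k) = turn n X k \<circ> turn n X k \<circ> turn n X k"
  by (rule inv_unique_comp) (simp_all add: fun_eq_iff turn_turn_turn_turn)

text \<open>Turns replace inverse turns, since the inverse of a turn is its third power.\<close>

lemma valid_config_comp_turn:
  assumes "valid_config n s" "1 \<le> k" "k \<le> n div 2"
  shows "valid_config n (s \<circ> turn n X k)"
proof -
  let ?i = "inv (turn n X k)"
  have "turn n X k = ?i \<circ> ?i \<circ> ?i"
    by (simp add: inv_turn fun_eq_iff turn_turn_turn_turn)
  moreover have "valid_config n (s \<circ> ?i \<circ> ?i \<circ> ?i)"
    using assms by (intro valid_config.move)
  ultimately show ?thesis by (metis comp_assoc)
qed

text \<open>The induction behind all invariants below. Its step composes with \<open>turn\<close>,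
  which has an explicit formula, rather than with an inverse; one move amounts to three such
  steps.\<close>

lemma valid_config_turn_induct [consumes 1, case_names solved turn]:
  assumes "valid_config n s"
    and "P id"
    and turn: "\<And>s X k. valid_config n s \<Longrightarrow> P s \<Longrightarrow> 1 \<le> k \<Longrightarrow> k \<le> n div 2 \<Longrightarrow>
      P (s \<circ> turn n X k)"
  shows "P s"
  using assms(1)
proof induction
  case solved
  show ?case by fact
next
  case (move s k X)
  let ?t = "turn n X k"
  have "P (s \<circ> ?t \<circ> ?t \<circ> ?t)"
    using move by (intro turn valid_config_comp_turn)
  then show ?case by (simp only: inv_turn comp_assoc)
qed

lemma valid_config_in_facelets:
  "valid_config n s \<Longrightarrow> f \<in> facelets n \<Longrightarrow> s f \<in> facelets n"
  by (induction arbitrary: f rule: valid_config_turn_induct) (auto simp: turn_in_facelets)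

text \<open>A turn sends all facelets of one position to one position. This makes the definite
  description in \<open>cubie_at\<close> proper, whichever facelet the cubie is read off.\<close>

lemma valid_config_coherent:
  "valid_config n s \<Longrightarrow> f \<in> facelets n \<Longrightarrow> g \<in> facelets n \<Longrightarrow> fst f = fst g \<Longrightarrow>
   fst (s f) = fst (s g)"
proof (induction arbitrary: f g rule: valid_config_turn_induct)
  case (turn s X k)
  then show ?case by (simp add: turn_in_facelets fst_turn)
qed simp

lemma cubie_at_eq:
  assumes "valid_config n s" "(p, d) \<in> facelets n"
  shows "cubie_at n s p = fst (s (p, d))"
  unfolding cubie_at_def
proof (rule the_equality)
  show "\<forall>d'. (p, d') \<in> facelets n \<longrightarrow> fst (s (p, d')) = fst (s (p, d))"
    using valid_config_coherent[OF assms(1) _ assms(2)] by auto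
qed (use assms(2) in metis)

lemma cubie_at_comp_turn:
  assumes "valid_config n s" "1 \<le> k" "k \<le> n div 2" "(p, d) \<in> facelets n"
  shows "cubie_at n (s \<circ> turn n X k) p = cubie_at n s (position_turn n X k p)"
proof -
  have "turn n X k (p, d) = (position_turn n X k p, snd (turn n X k (p, d)))"
    using fst_turn[OF assms(4)] by (simp add: prod_eq_iff)
  moreover have "turn n X k (p, d) \<in> facelets n"
    using assms(4) by (rule turn_in_facelets)
  ultimately have "cubie_at n s (position_turn n X k p) = fst (s (turn n X k (p, d)))"
    using cubie_at_eq[OF assms(1)] by metis
  then show ?thesis
    using cubie_at_eq[OF valid_config_comp_turn[OF assms(1-3)] assms(4)] by simp
qed

section \<open>Signs of quarter turns\<close>

text \<open>Since \<open>g \<circ> g\<close> has no fixed point, every cycle has length exactly 4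
  and is therefore odd. The induction splits off one cycle at a time.\<close>

lemma sign_perm_restrict_order4:
  assumes "finite A"
    and "\<And>x. x \<in> A \<Longrightarrow> g x \<in> A"
    and "\<And>x. x \<in> A \<Longrightarrow> g (g (g (g x))) = x"
    and "\<And>x. x \<in> A \<Longrightarrow> g (g x) \<noteq> x"
  shows "perm_restrict g A permutes A \<and> sign (perm_restrict g A) = (-1) ^ (card A div 4)"
  using assms
proof (induction A rule: finite_psubset_induct)
  case (psubset A)
  show ?case
  proof (cases "A = {}")
    case True
    then have "perm_restrict g A = id" by (auto simp: perm_restrict_def fun_eq_iff)
    then show ?thesis using True by (simp add: fun_eq_iff)
  next
    case False
    then obtain x where x: "x \<in> A" by auto
    define C where "C = {x, g x, g (g x), g (g (g x))}"
    \<comment> \<open>The 4-cycle through \<open>x\<close> as a product of three transpositions,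
      which gives its sign -1.\<close>
    define c where "c = transpose x (g x) \<circ> transpose (g x) (g (g x)) \<circ>
      transpose (g (g x)) (g (g (g x)))"
    have CA: "C \<subseteq> A" using x psubset.prems(1) by (auto simp: C_def)
    have g4: "g (g (g (g x))) = x" using x psubset.prems(2) by blast
    have dist: "g (g x) \<noteq> x" "g (g (g x)) \<noteq> g x" "g x \<noteq> x" "g (g x) \<noteq> g x"
      "g (g (g x)) \<noteq> g (g x)" "g (g (g x)) \<noteq> x"
      using x psubset.prems(1,3) g4 by metis+
    have card_C: "card C = 4" using dist by (simp add: C_def)
    have "card (A - C) = card A - 4"
      using card_C CA psubset.hyps by (metis card_Diff_subset finite_subset)
    moreover have "card A \<ge> 4"
      using card_C CA psubset.hyps by (metis card_mono)
    ultimately have card: "card A div 4 = Suc (card (A - C) div 4)" by simp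
    have closed: "g y \<in> A - C" if "y \<in> A - C" for y
    proof -
      \<comment> \<open>Three further steps stay on the cycle and lead back to
        \<open>y\<close>.\<close>
      have "y \<in> C" if "g y \<in> C"
      proof -
        have "g (g (g (g y))) \<in> C" using that g4 by (auto simp: C_def)
        then show ?thesis using \<open>y \<in> A - C\<close> psubset.prems(2) by auto
      qed
      then show ?thesis using that psubset.prems(1) by auto
    qed
    have IH: "perm_restrict g (A - C) permutes (A - C) \<and>
        sign (perm_restrict g (A - C)) = (-1) ^ (card (A - C) div 4)"
      by (rule psubset.IH) (use closed psubset.prems C_def x in auto)
    have c_perm: "c permutes A"
      using CA unfolding c_def C_def
      by (intro permutes_compose permutes_swap_id) auto
    have perm: "perm_restrict g (A - C) permutes A"
      using IH by (auto intro: permutes_subset)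
    have eq: "perm_restrict g A = perm_restrict g (A - C) \<circ> c"
    proof
      fix y
      show "perm_restrict g A y = (perm_restrict g (A - C) \<circ> c) y"
      proof (cases "y \<in> C")
        case True
        then have "c y = g y \<and> g y \<in> C"
          using dist g4 by (auto simp: C_def c_def transpose_def)
        then show ?thesis using True CA by (auto simp: perm_restrict_def)
      next
        case False
        then have "c y = y" by (auto simp: C_def c_def transpose_def)
        then show ?thesis using False by (auto simp: perm_restrict_def)
      qed
    qed
    have "sign c = -1"
      using dist unfolding c_def
      by (simp add: sign_compose sign_swap_id permutation_swap_id permutation_compose)
    moreover have "permutation (perm_restrict g (A - C))" "permutation c"
      using perm c_perm psubset.hyps permutation_permutes by blast+
    ultimately have "sign (perm_restrict g A) = (-1) ^ (card A div 4)"
      using IH by (simp add: eq sign_compose card)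
    moreover have "perm_restrict g A permutes A"
      unfolding eq using c_perm perm by (rule permutes_compose)
    ultimately show ?thesis by blast
  qed
qed

text \<open>The form in which turns meet every orbit: \<open>g\<close> rotates the whole cube,
  \<open>Q\<close> singles out the turned slice, and \<open>s\<close> and \<open>t\<close> are the
  configurations before and after. On \<open>A\<close>, \<open>t\<close> is \<open>s\<close>
  composed with \<open>g\<close> cut down to the slice.\<close>

lemma sign_perm_restrict_quarter_turn:
  assumes fin: "finite A"
    and g: "\<And>x. x \<in> A \<Longrightarrow> g x \<in> A" "\<And>x. x \<in> A \<Longrightarrow> g (g (g (g x))) = x"
    and Q: "\<And>x. x \<in> A \<Longrightarrow> Q (g x) \<longleftrightarrow> Q x" "\<And>x. x \<in> A \<Longrightarrow> Q x \<Longrightarrow> g (g x) \<noteq> x"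
    and s: "perm_restrict s A permutes A"
    and t: "\<And>x. x \<in> A \<Longrightarrow> t x = s (if Q x then g x else x)"
  shows "perm_restrict t A permutes A \<and>
    sign (perm_restrict t A) = sign (perm_restrict s A) * (-1) ^ (card {x \<in> A. Q x} div 4)"
proof -
  let ?B = "{x \<in> A. Q x}"
  have B: "perm_restrict g ?B permutes ?B \<and> sign (perm_restrict g ?B) = (-1) ^ (card ?B div 4)"
    by (rule sign_perm_restrict_order4) (use fin g Q in auto)
  then have B': "perm_restrict g ?B permutes A" by (auto intro: permutes_subset)
  have eq: "perm_restrict t A = perm_restrict s A \<circ> perm_restrict g ?B"
    using t g by (auto simp: perm_restrict_def fun_eq_iff)
  have "permutation (perm_restrict s A)" "permutation (perm_restrict g ?B)"
    using B' s fin permutation_permutes by blast+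
  then show ?thesis
    unfolding eq using B B' s by (auto simp: sign_compose intro: permutes_compose)
qed

text \<open>The rotation group is transitive on the faces, so slices need to be counted for one face only.\<close>

lemma card_slice_eq_Right:
  fixes g :: "face \<Rightarrow> 'a \<Rightarrow> 'a" and pos :: "'a \<Rightarrow> vec"
  assumes "finite A"
    and "\<And>Z x. x \<in> A \<Longrightarrow> g Z x \<in> A"
    and "\<And>Z x. x \<in> A \<Longrightarrow> g Z (g Z (g Z (g Z x))) = x"
    and "\<And>Z x. pos (g Z x) = rot_cw Z (pos x)"
  shows "card {x \<in> A. dot (pos x) (normal X) = w} = card {x \<in> A. dot (pos x) (normal Right) = w}"
proof -
  define c where "c = (\<lambda>d. card {x \<in> A. dot (pos x) d = w})"
  \<comment> \<open>Rotation about \<open>Z\<close> injects the slice in direction \<open>d\<close>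
    into the slice in the rotated direction.\<close>
  have step: "c d \<le> c (rot_cw Z d)" for Z d
    unfolding c_def
  proof (rule card_inj_on_le)
    show "inj_on (g Z) {x \<in> A. dot (pos x) d = w}"
      by (rule inj_on_inverseI[where g = "\<lambda>x. g Z (g Z (g Z x))"]) (use assms(3) in auto)
    show "g Z ` {x \<in> A. dot (pos x) d = w} \<subseteq> {x \<in> A. dot (pos x) (rot_cw Z d) = w}"
      using assms(2,4) by auto
  qed (use assms(1) in auto)
  \<comment> \<open>Going once around the front axis and once around the upper axis yields two
    closed chains of inequalities through \<open>(1, 0, 0)\<close>. Together they reach all six
    directions and force equality.\<close>
  have "c (1, 0, 0) \<le> c (0, -1, 0)" "c (0, -1, 0) \<le> c (-1, 0, 0)"
    "c (-1, 0, 0) \<le> c (0, 1, 0)" "c (0, 1, 0) \<le> c (1, 0, 0)"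
    using step[of "(1, 0, 0)" Front] step[of "(0, -1, 0)" Front] step[of "(-1, 0, 0)" Front]
      step[of "(0, 1, 0)" Front] by simp_all
  moreover have "c (1, 0, 0) \<le> c (0, 0, 1)" "c (0, 0, 1) \<le> c (-1, 0, 0)"
    "c (-1, 0, 0) \<le> c (0, 0, -1)" "c (0, 0, -1) \<le> c (1, 0, 0)"
    using step[of "(1, 0, 0)" Up] step[of "(0, 0, 1)" Up] step[of "(-1, 0, 0)" Up]
      step[of "(0, 0, -1)" Up] by simp_all
  ultimately have "c (normal X) = c (normal Right)" by (cases X) auto
  then show ?thesis by (simp add: c_def)
qed

section \<open>Slices of the orbits\<close>

lemma rot_cw_in_corners: "p \<in> corners n \<Longrightarrow> rot_cw X p \<in> corners n"
  by (cases X) (auto simp: corners_def Let_def)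

lemma finite_corners: "finite (corners n)"
  by (simp add: corners_def Let_def)

lemma rot_cw_rot_cw_corners:
  assumes "n \<ge> 3" "p \<in> corners n"
  shows "rot_cw X (rot_cw X p) \<noteq> p"
  using assms by (cases X) (auto simp: corners_def Let_def)

lemma card_corners_slice:
  assumes "n \<ge> 3" "w > 0"
  shows "card {p \<in> corners n. dot p (normal X) = w} = (if w = int n - 1 then 4 else 0)"
proof -
  have "{p \<in> corners n. dot p (normal Right) = w} =
    (if w = int n - 1 then {w} \<times> {1 - int n, int n - 1} \<times> {1 - int n, int n - 1} else {})"
    using assms by (auto simp: corners_def Let_def)
  then have "card {p \<in> corners n. dot p (normal Right) = w} = (if w = int n - 1 then 4 else 0)"
    using assms by (simp add: card_cartesian_product)
  then show ?thesis
    using card_slice_eq_Right[where A = "corners n" and g = rot_cw and pos = "\<lambda>p. p"]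
    by (simp add: finite_corners rot_cw_in_corners)
qed

text \<open>Here \<open>m\<close> is the coordinate of an outer layer and \<open>u\<close> the
  offset along the edge. In explicit coordinates, closure under rotations and slice counts become
  finite computations.\<close>

definition edge_positions :: "int \<Rightarrow> int \<Rightarrow> vec set" where
  "edge_positions m u = {m, -m} \<times> {m, -m} \<times> {u, -u} \<union> {m, -m} \<times> {u, -u} \<times> {m, -m} \<union>
    {u, -u} \<times> {m, -m} \<times> {m, -m}"

lemma edge_cubies_eq: "edge_cubies n t = edge_positions (int n - 1) (int n + 1 - 2 * int t)"
proof -
  define m u where "m = int n - 1" and "u = int n + 1 - 2 * int t"
  have u: "2 * int t - int n - 1 = - u" by (simp add: u_def)
  \<comment> \<open>For fixed faces this is a singleton or empty, so the union over all pairs of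
    faces unfolds to an explicit finite set.\<close>
  define P where "P = (\<lambda>X Y. {p. p = scale m (normal X + normal Y) +
      scale (- u) (cross (normal X) (normal Y)) \<and> dot (normal X) (normal Y) = 0})"
  have "edge_cubies n t = (\<Union>X. \<Union>Y. P X Y)"
    by (auto simp: edge_cubies_def u m_def P_def)
  also have "\<dots> = edge_positions m u"
  proof
    show "(\<Union>X. \<Union>Y. P X Y) \<subseteq> edge_positions m u"
      unfolding UNIV_face by (simp add: P_def edge_positions_def)
    show "edge_positions m u \<subseteq> (\<Union>X. \<Union>Y. P X Y)"
      unfolding UNIV_face by (simp add: P_def edge_positions_def insert_Times_insert)
  qed
  finally show ?thesis by (simp add: m_def u_def)
qed

lemma rot_cw_in_edge_cubies: "p \<in> edge_cubies n t \<Longrightarrow> rot_cw X p \<in> edge_cubies n t"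
proof -
  have "p \<in> edge_positions m u \<Longrightarrow> rot_cw X p \<in> edge_positions m u" for m u
  proof -
    have "rot_cw X ` edge_positions m u \<subseteq> edge_positions m u"
      by (cases X) (simp_all add: edge_positions_def)
    then show "p \<in> edge_positions m u \<Longrightarrow> rot_cw X p \<in> edge_positions m u" by blast
  qed
  then show "p \<in> edge_cubies n t \<Longrightarrow> rot_cw X p \<in> edge_cubies n t"
    by (simp add: edge_cubies_eq)
qed

lemma finite_edge_cubies: "finite (edge_cubies n t)"
  by (simp add: edge_cubies_eq edge_positions_def)

text \<open>A half turn fixes only points on its axis, and edge cubies have two nonzero
  coordinates.\<close>

lemma rot_cw_rot_cw_edge_cubies:
  assumes "n \<ge> 3" "p \<in> edge_cubies n t"
  shows "rot_cw X (rot_cw X p) \<noteq> p"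
proof -
  define m u where "m = int n - 1" and "u = int n + 1 - 2 * int t"
  have "m \<noteq> 0" using assms(1) by (simp add: m_def)
  moreover have "p \<in> edge_positions m u" using assms(2) by (simp add: edge_cubies_eq m_def u_def)
  ultimately show ?thesis by (cases X) (auto simp: edge_positions_def)
qed

text \<open>An outer layer contains four whole edges with two cubies each; an inner layer meets only
  the four edges parallel to the axis. The bound \<open>2 * t < n + 1\<close> keeps the two cubies
  of an edge distinct, and \<open>w > 0\<close> separates the layer from its mirror image.\<close>

lemma card_edge_cubies_slice:
  assumes "1 < t" "2 * t < n + 1" "w > 0"
  shows "card {p \<in> edge_cubies n t. dot p (normal X) = w} =
    (if w = int n - 1 then 8 else if w = int n + 1 - 2 * int t then 4 else 0)"
proof -
  define m u where "m = int n - 1" and "u = int n + 1 - 2 * int t"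
  have mu: "0 < u" "u < m" using assms by (auto simp: m_def u_def)
  have "card (edge_positions m u \<inter> {p. dot p (normal Right) = w}) =
      (if w = m then 8 else if w = u then 4 else 0)"
    using mu assms(3) by (cases "w = m"; cases "w = u")
      (simp_all add: edge_positions_def Int_insert_left)
  moreover have "edge_cubies n t = edge_positions m u"
    by (simp add: edge_cubies_eq m_def u_def)
  moreover have "card {p \<in> edge_cubies n t. dot p (normal X) = w} =
      card {p \<in> edge_cubies n t. dot p (normal Right) = w}"
    by (rule card_slice_eq_Right[where g = rot_cw and pos = "\<lambda>p. p"])
      (simp_all add: finite_edge_cubies rot_cw_in_edge_cubies)
  ultimately show ?thesis by (simp add: Int_def m_def u_def)
qed

lemma single_edges_eq:
  assumes "odd n"
  shows "single_edges n = edge_positions (int n - 1) 0"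
proof -
  have "int n + 1 - 2 * int ((n + 1) div 2) = 0" using assms by (auto elim: oddE)
  then show ?thesis by (simp add: single_edges_def edge_cubies_eq)
qed

lemma card_single_edges_slice:
  assumes "n \<ge> 3" "odd n" "w > 0"
  shows "card {p \<in> single_edges n. dot p (normal X) = w} = (if w = int n - 1 then 4 else 0)"
proof -
  define m where "m = int n - 1"
  have m: "0 < m" using assms by (auto simp: m_def)
  note E = single_edges_eq[OF assms(2), folded m_def, unfolded edge_positions_def]
  have "{p \<in> single_edges n. dot p (normal Right) = w} =
    (if w = m then {(m, m, 0), (m, -m, 0), (m, 0, m), (m, 0, -m)} else {})"
    using m assms(3) by (auto simp: E)
  then have "card {p \<in> single_edges n. dot p (normal Right) = w} = (if w = m then 4 else 0)"
    using m by simp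
  then show ?thesis
    using card_slice_eq_Right[where A = "single_edges n" and g = rot_cw and pos = "\<lambda>p. p"]
    by (simp add: finite_edge_cubies rot_cw_in_edge_cubies single_edges_def m_def)
qed

text \<open>The images of the facelet at \<open>(u, v, m)\<close> on the front face under the rotation group.\<close>

definition center_facelets :: "int \<Rightarrow> int \<Rightarrow> int \<Rightarrow> facelet set" where
  "center_facelets m u v = (\<Union>(a, b) \<in> {(u, v), (v, -u), (-u, -v), (-v, u)}.
    {((a, b, m), (0, 0, 1)), ((m, a, b), (1, 0, 0)), ((b, m, a), (0, 1, 0)),
     ((a, -b, -m), (0, 0, -1)), ((-m, a, -b), (-1, 0, 0)), ((b, -m, -a), (0, -1, 0))})"

lemma center_edge_orbit_eq:
  assumes "i \<le> n + 1" "j \<le> n + 1"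
  shows "center_edge_orbit n i j =
    center_facelets (int n - 1) (int n + 1 - 2 * int i) (int n + 1 - 2 * int j)"
proof -
  define m and a :: "nat \<Rightarrow> int" where "m = int n - 1" and "a = (\<lambda>r. int n + 1 - 2 * int r)"
  have a: "2 * int r - int n - 1 = - a r" for r by (simp add: a_def)
  \<comment> \<open>The bounds on \<open>i\<close> and \<open>j\<close> keep the natural subtraction
    from truncating; counting from the opposite side then negates the coordinate.\<close>
  have flip: "a (n + 1 - i) = - a i" "a (n + 1 - j) = - a j"
    using assms by (simp_all add: a_def of_nat_diff)
  have "center_edge_orbit n i j = (\<Union>X. {facelet_at n X i j, facelet_at n X j (n + 1 - i),
      facelet_at n X (n + 1 - i) (n + 1 - j), facelet_at n X (n + 1 - j) i})"
    by (auto simp: center_edge_orbit_def)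
  also have "\<dots> = center_facelets m (a i) (a j)"
    unfolding facelet_at_def a flip m_def[symmetric] UNIV_face center_facelets_def
    by (rule equalityI) simp_all
  finally show ?thesis by (simp add: m_def a_def)
qed

text \<open>For \<open>j = i\<close> the four positions on a face are all of
  \<open>{i, n+1-i}\<close> squared, so center corners need no separate treatment.\<close>

lemma center_corner_orbit_eq: "center_corner_orbit n i = center_edge_orbit n i i"
  by (auto simp: center_corner_orbit_def center_edge_orbit_def)

lemma finite_center_facelets: "finite (center_facelets m u v)"
  by (auto simp: center_facelets_def)

lemma rot_facelet_in_center_facelets:
  "f \<in> center_facelets m u v \<Longrightarrow> rot_facelet X f \<in> center_facelets m u v"
proof -
  have "rot_facelet X ` center_facelets m u v \<subseteq> center_facelets m u v"
    by (cases X) (simp_all add: center_facelets_def)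
  then show "f \<in> center_facelets m u v \<Longrightarrow> rot_facelet X f \<in> center_facelets m u v" by blast
qed

text \<open>The entries \<open>m\<close> and \<open>u\<close> are nonzero, which keeps the facelets
  off the axes even when \<open>v = 0\<close>.\<close>

lemma rot_facelet_rot_facelet_center_facelets:
  assumes "0 < u" "0 < m" "f \<in> center_facelets m u v"
  shows "rot_facelet X (rot_facelet X f) \<noteq> f"
proof -
  have "\<forall>f \<in> center_facelets m u v. rot_facelet X (rot_facelet X f) \<noteq> f"
    using assms(1,2) by (cases X) (simp_all add: center_facelets_def)
  then show ?thesis using assms(3) by blast
qed

text \<open>The outer layer contains only the four facelets on its own face. An inner layer meets
  the four adjacent faces, each in one facelet for \<open>w = u\<close> and one for
  \<open>w = v\<close>; when \<open>u = v\<close> these are two distinct facelets, whence 8.\<close>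

lemma card_center_facelets_slice:
  assumes "0 < u" "u < m" "0 \<le> v" "v < m" "w > 0"
  shows "card {f \<in> center_facelets m u v. dot (fst f) (normal X) = w} =
    (if w = m then 4 else if w = u \<and> w = v then 8 else if w = u \<or> w = v then 4 else 0)"
proof -
  have "card (center_facelets m u v \<inter> {f. dot (fst f) (normal Right) = w}) =
    (if w = m then 4 else if w = u \<and> w = v then 8 else if w = u \<or> w = v then 4 else 0)"
    using assms by (cases "w = m"; cases "w = u"; cases "w = v")
      (simp_all add: center_facelets_def Int_insert_left)
  then show ?thesis
    using card_slice_eq_Right[where A = "center_facelets m u v" and g = rot_facelet and pos = fst]
    by (simp add: finite_center_facelets rot_facelet_in_center_facelets Int_def)
qed

section \<open>Signs of valid configurations\<close>

lemma layer_coords_extreme [simp]: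
  "n \<ge> 1 \<Longrightarrow> int n - 1 \<in> layer_coords n" "n \<ge> 1 \<Longrightarrow> 1 - int n \<in> layer_coords n"
  by (auto simp: layer_coords_def)

lemma layer_coords_slice [simp]:
  assumes "1 \<le> k" "k \<le> n"
  shows "int n + 1 - 2 * int k \<in> layer_coords n" "2 * int k - (int n + 1) \<in> layer_coords n"
  using assms by (auto simp: layer_coords_def)

lemma corner_facelets_iff:
  assumes "n \<ge> 3" "p \<in> corners n"
  shows "(p, d) \<in> facelets n \<longleftrightarrow> d \<in> range normal \<and> dot p d = int n - 1"
  using assms by (auto simp: facelets_iff corners_def Let_def)

lemma edge_facelets_iff:
  assumes "1 \<le> t" "t \<le> n" "p \<in> edge_cubies n t"
  shows "(p, d) \<in> facelets n \<longleftrightarrow> d \<in> range normal \<and> dot p d = int n - 1"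
  using assms by (auto simp: facelets_iff edge_cubies_eq edge_positions_def)

text \<open>Collects what corners, single edges and coupled edges share: a facelet at each position,
  so that \<open>cubie_at\<close> is determined, and no position on a rotation axis, so that quarter
  turns have only 4-cycles.\<close>

definition position_orbit :: "nat \<Rightarrow> vec set \<Rightarrow> bool" where
  "position_orbit n P \<longleftrightarrow> finite P \<and>
    (\<forall>p \<in> P. (\<exists>d. (p, d) \<in> facelets n) \<and> (\<forall>X. rot_cw X p \<in> P \<and> rot_cw X (rot_cw X p) \<noteq> p))"

lemma position_orbit_corners: "n \<ge> 3 \<Longrightarrow> position_orbit n (corners n)"
proof -
  assume n: "n \<ge> 3"
  have "\<exists>d. (p, d) \<in> facelets n" if "p \<in> corners n" for p
  proof -
    have "\<exists>d \<in> range normal. dot p d = int n - 1"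
      using that by (auto simp: corners_def Let_def range_normal)
    then show ?thesis using n that corner_facelets_iff by blast
  qed
  then show ?thesis
    using n by (simp add: position_orbit_def finite_corners rot_cw_in_corners rot_cw_rot_cw_corners)
qed

lemma position_orbit_edge_cubies:
  assumes "n \<ge> 3" "1 \<le> t" "t \<le> n"
  shows "position_orbit n (edge_cubies n t)"
proof -
  have "\<exists>d. (p, d) \<in> facelets n" if "p \<in> edge_cubies n t" for p
  proof -
    have "\<exists>d \<in> range normal. dot p d = int n - 1"
      using that by (auto simp: edge_cubies_eq edge_positions_def range_normal)
    then show ?thesis using assms that edge_facelets_iff by blast
  qed
  then show ?thesis
    using assms(1)
    by (simp add: position_orbit_def finite_edge_cubies rot_cw_in_edge_cubies
        rot_cw_rot_cw_edge_cubies)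
qed

lemma position_orbit_single_edges: "n \<ge> 3 \<Longrightarrow> position_orbit n (single_edges n)"
  by (auto simp: single_edges_def intro!: position_orbit_edge_cubies)

lemma position_orbit_turn:
  assumes "position_orbit n P" "valid_config n s" "1 \<le> k" "k \<le> n div 2"
    and "perm_restrict (cubie_at n s) P permutes P"
  shows "perm_restrict (cubie_at n (s \<circ> turn n X k)) P permutes P \<and>
    sign (perm_restrict (cubie_at n (s \<circ> turn n X k)) P) =
    sign (perm_restrict (cubie_at n s) P) *
    (-1) ^ (card {p \<in> P. dot p (normal X) = int n + 1 - 2 * int k} div 4)"
proof (rule sign_perm_restrict_quarter_turn[where g = "rot_cw X"])
  fix p assume "p \<in> P"
  then obtain d where "(p, d) \<in> facelets n" using assms(1) by (auto simp: position_orbit_def)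
  then show "cubie_at n (s \<circ> turn n X k) p =
      cubie_at n s (if dot p (normal X) = int n + 1 - 2 * int k then rot_cw X p else p)"
    using cubie_at_comp_turn[OF assms(2-4)] by (simp add: position_turn_def slice_def)
qed (use assms(1,5) in \<open>auto simp: position_orbit_def\<close>)

lemma position_orbit_id:
  assumes "position_orbit n P"
  shows "perm_restrict (cubie_at n id) P = id"
proof -
  have "cubie_at n id p = p" if "p \<in> P" for p
    using that assms cubie_at_eq[OF valid_config.solved] by (fastforce simp: position_orbit_def)
  then show ?thesis by (auto simp: perm_restrict_def)
qed

lemma position_orbit_permutes:
  assumes "valid_config n s" "position_orbit n P"
  shows "perm_restrict (cubie_at n s) P permutes P"
  using assms(1)
proof (induction rule: valid_config_turn_induct)
  case solved
  show ?case by (simp only: position_orbit_id[OF assms(2)] permutes_id)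
next
  case (turn s X k)
  then show ?case using position_orbit_turn[OF assms(2)] by blast
qed

lemmas sign_position_orbit_turn =
  position_orbit_turn[OF _ _ _ _ position_orbit_permutes, THEN conjunct2]

lemma sign_corner_perm_turn:
  assumes "n \<ge> 3" "valid_config n s" "1 \<le> k" "k \<le> n div 2"
  shows "sign (corner_perm n (s \<circ> turn n X k)) = sign (corner_perm n s) * (if k = 1 then -1 else 1)"
  using sign_position_orbit_turn[OF position_orbit_corners assms(2-4) assms(2) position_orbit_corners]
    assms by (auto simp: corner_perm_def card_corners_slice)

lemma sign_single_edge_perm_turn:
  assumes "n \<ge> 3" "odd n" "valid_config n s" "1 \<le> k" "k \<le> n div 2"
  shows "sign (single_edge_perm n (s \<circ> turn n X k)) =
    sign (single_edge_perm n s) * (if k = 1 then -1 else 1)"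
proof -
  note P = position_orbit_single_edges[OF assms(1)]
  show ?thesis
    using sign_position_orbit_turn[OF P assms(3-5) assms(3) P] assms
    by (auto simp: single_edge_perm_def card_single_edges_slice)
qed

text \<open>A face turn moves eight of these cubies, in two 4-cycles, and so is even; only the
  \<open>i\<close>-th slices give a single 4-cycle.\<close>

lemma sign_coupled_edge_perm_turn:
  assumes "i \<in> {2..(n - 1) div 2}" "valid_config n s" "1 \<le> k" "k \<le> n div 2"
  shows "sign (coupled_edge_perm n i (s \<circ> turn n X k)) =
    sign (coupled_edge_perm n i s) * (if k = i then -1 else 1)"
proof -
  have P: "position_orbit n (edge_cubies n i)"
    using assms by (auto intro!: position_orbit_edge_cubies)
  have "card {p \<in> edge_cubies n i. dot p (normal X) = int n + 1 - 2 * int k} =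
    (if k = 1 then 8 else if k = i then 4 else 0)"
    using assms by (subst card_edge_cubies_slice) auto
  then show ?thesis
    using sign_position_orbit_turn[OF P assms(2-4) assms(2) P] assms(1)
    by (auto simp: coupled_edge_perm_def)
qed

lemma center_edge_perm_id: "center_edge_perm n i j id = id"
  by (auto simp: center_edge_perm_def perm_restrict_def)

text \<open>The range of \<open>j\<close> includes \<open>j = i\<close>, which serves the center
  corners, and the middle index, where \<open>v = 0\<close>.\<close>

context
  fixes n i j :: nat
  assumes ij: "i \<in> {2..(n - 1) div 2}" "j \<in> {2..(n + 1) div 2}"
begin

lemma center_edge_orbit_eq':
  "center_edge_orbit n i j =
    center_facelets (int n - 1) (int n + 1 - 2 * int i) (int n + 1 - 2 * int j)"
  using ij by (intro center_edge_orbit_eq) auto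

lemma center_edge_orbit_subset_facelets: "center_edge_orbit n i j \<subseteq> facelets n"
  using ij by (fastforce simp: center_edge_orbit_def facelets_def)

lemma center_edge_perm_turn:
  assumes "1 \<le> k" "k \<le> n div 2" "center_edge_perm n i j s permutes center_edge_orbit n i j"
  shows "center_edge_perm n i j (s \<circ> turn n X k) permutes center_edge_orbit n i j \<and>
    sign (center_edge_perm n i j (s \<circ> turn n X k)) = sign (center_edge_perm n i j s) *
    (-1) ^ (card {f \<in> center_edge_orbit n i j. dot (fst f) (normal X) = int n + 1 - 2 * int k} div 4)"
  unfolding center_edge_perm_def
proof (rule sign_perm_restrict_quarter_turn[where g = "rot_facelet X"])
  fix f assume f: "f \<in> center_edge_orbit n i j"
  show "rot_facelet X (rot_facelet X f) \<noteq> f"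
    using f ij unfolding center_edge_orbit_eq'
    by (intro rot_facelet_rot_facelet_center_facelets) auto
  from f show "(s \<circ> turn n X k) f =
      s (if dot (fst f) (normal X) = int n + 1 - 2 * int k then rot_facelet X f else f)"
    using center_edge_orbit_subset_facelets by (auto simp: turn_eq slice_def)
qed (use ij assms(3) in \<open>auto simp: center_edge_orbit_eq' finite_center_facelets
    rot_facelet_in_center_facelets center_edge_perm_def\<close>)

lemma center_edge_perm_permutes:
  assumes "valid_config n s"
  shows "center_edge_perm n i j s permutes center_edge_orbit n i j"
  using assms
proof (induction rule: valid_config_turn_induct)
  case solved
  show ?case by (simp only: center_edge_perm_id permutes_id)
next
  case (turn s X k)
  then show ?case using center_edge_perm_turn by blast
qed

text \<open>When \<open>k = i = j\<close> there are two 4-cycles and the sign is kept. Center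
  corners therefore change sign under face turns only.\<close>

lemma sign_center_edge_perm_turn:
  assumes "valid_config n s" "1 \<le> k" "k \<le> n div 2"
  shows "sign (center_edge_perm n i j (s \<circ> turn n X k)) = sign (center_edge_perm n i j s) *
    (if k = 1 then -1 else if k = i \<and> k = j then 1 else if k = i \<or> k = j then -1 else 1)"
proof -
  have "card {f \<in> center_edge_orbit n i j. dot (fst f) (normal X) = int n + 1 - 2 * int k} =
    (if k = 1 then 4 else if k = i \<and> k = j then 8 else if k = i \<or> k = j then 4 else 0)"
    unfolding center_edge_orbit_eq' using ij assms
    by (subst card_center_facelets_slice) auto
  then show ?thesis
    using center_edge_perm_turn[OF assms(2,3) center_edge_perm_permutes[OF assms(1)]] by auto
qed

end

lemma center_corner_perm_eq: "center_corner_perm n i s = center_edge_perm n i i s"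
  by (simp add: center_corner_perm_def center_edge_perm_def center_corner_orbit_eq)

lemma sign_center_edge_perm_id: "sign (center_edge_perm n i j id) = 1"
  by (simp only: center_edge_perm_id sign_id)

section \<open>Orientations\<close>

lemma valid_config_position:
  assumes "valid_config n s" "position_orbit n P" "f \<in> facelets n" "fst f \<in> P"
  shows "fst (s f) \<in> P"
  using assms(1,3,4)
proof (induction arbitrary: f rule: valid_config_turn_induct)
  case (turn s X k)
  then show ?case
    using assms(2) by (simp add: turn_in_facelets fst_turn position_turn_def position_orbit_def)
qed simp

text \<open>Shared by corners (\<open>q = 3\<close>) and single edges (\<open>q = 2\<close>). The
  assumption \<open>face\<close> allows reading on the turned face; \<open>potential\<close> asks
  for invariance of differences within a cubie only.\<close>

context
  fixes n :: nat and P :: "vec set" and \<phi> :: "facelet \<Rightarrow> int" and q :: int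
  assumes P: "position_orbit n P"
    and face: "\<And>X k p. 1 \<le> k \<Longrightarrow> k \<le> n div 2 \<Longrightarrow> p \<in> P \<Longrightarrow> p \<in> slice n X k \<Longrightarrow>
      (p, normal X) \<in> facelets n"
    and potential: "\<And>X f g. f \<in> facelets n \<Longrightarrow> g \<in> facelets n \<Longrightarrow> fst f \<in> P \<Longrightarrow> fst g = fst f \<Longrightarrow>
      [\<phi> (rot_facelet X f) - \<phi> (rot_facelet X g) = \<phi> f - \<phi> g] (mod q)"
begin

text \<open>Two facelets at one position are either both rotated or both left alone, so a turn
  preserves their difference in either case.\<close>

lemma valid_config_potential_diff:
  assumes "valid_config n s" "f \<in> facelets n" "g \<in> facelets n" "fst f \<in> P" "fst g = fst f"
  shows "[\<phi> (s f) - \<phi> (s g) = \<phi> f - \<phi> g] (mod q)"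
  using assms
proof (induction arbitrary: f g rule: valid_config_turn_induct)
  case (turn s X k)
  have "[\<phi> (s (turn n X k f)) - \<phi> (s (turn n X k g)) = \<phi> (turn n X k f) - \<phi> (turn n X k g)] (mod q)"
    by (rule turn.IH)
      (use turn.prems P in \<open>simp_all add: turn_in_facelets fst_turn position_turn_def position_orbit_def\<close>)
  also have "[\<phi> (turn n X k f) - \<phi> (turn n X k g) = \<phi> f - \<phi> g] (mod q)"
    using turn.prems potential by (simp add: turn_eq)
  finally show ?case by simp
qed simp

text \<open>Conservation of the total twist: \<open>F\<close> selects one facelet per position, and
  the stickers there have the same total potential as the facelets themselves. Keeping
  \<open>F\<close> arbitrary lets the induction change the selection to suit the turn.\<close>

lemma valid_config_potential_sum:
  assumes "valid_config n s" "\<And>p. p \<in> P \<Longrightarrow> (p, F p) \<in> facelets n"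
  shows "[(\<Sum>p\<in>P. \<phi> (s (p, F p))) = (\<Sum>p\<in>P. \<phi> (p, F p))] (mod q)"
  using assms
proof (induction arbitrary: F rule: valid_config_turn_induct)
  case (turn s X k)
  let ?t = "turn n X k" and ?pt = "position_turn n X k"
  \<comment> \<open>The rotation fixes \<open>normal X\<close>, so the turn permutes the facelets
    selected by \<open>G\<close>.\<close>
  define G where "G p = (if p \<in> slice n X k then normal X else F p)" for p
  have G: "(p, G p) \<in> facelets n" if "p \<in> P" for p
    using that turn face by (simp add: G_def)
  have t: "?t (p, G p) = (?pt p, G (?pt p))" if "p \<in> P" for p
    using G[OF that] by (auto simp: turn_eq position_turn_def G_def)
  have bij: "bij_betw ?pt P P"
    by (rule bij_betw_byWitness[where f' = "\<lambda>p. ?pt (?pt (?pt p))"])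
      (use P in \<open>auto simp: position_turn_def position_orbit_def\<close>)
  \<comment> \<open>Replacing \<open>F p\<close> by \<open>G p\<close> changes the potentials of
    sticker and facelet by the same amount, by the preceding lemma for the turned
    configuration.\<close>
  have "[\<phi> (s (?t (p, F p))) - \<phi> (p, F p) = \<phi> (s (?t (p, G p))) - \<phi> (p, G p)] (mod q)"
    if "p \<in> P" for p
    using valid_config_potential_diff[OF valid_config_comp_turn[OF turn.hyps(1,2,3)],
        of "(p, F p)" "(p, G p)" X] turn.prems[OF that] G[OF that] that
    by (simp add: cong_diff_iff_cong_0 cong_iff_dvd_diff algebra_simps)
  then have "[(\<Sum>p\<in>P. \<phi> (s (?t (p, F p))) - \<phi> (p, F p)) =
      (\<Sum>p\<in>P. \<phi> (s (?t (p, G p))) - \<phi> (p, G p))] (mod q)"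
    by (rule cong_sum)
  also have "(\<Sum>p\<in>P. \<phi> (s (?t (p, G p))) - \<phi> (p, G p)) =
      (\<Sum>p\<in>P. \<phi> (s (?pt p, G (?pt p)))) - (\<Sum>p\<in>P. \<phi> (p, G p))"
    by (simp add: t sum_subtractf)
  also have "(\<Sum>p\<in>P. \<phi> (s (?pt p, G (?pt p)))) = (\<Sum>p\<in>P. \<phi> (s (p, G p)))"
    using bij by (rule sum.reindex_bij_betw)
  also have "[(\<Sum>p\<in>P. \<phi> (s (p, G p))) - (\<Sum>p\<in>P. \<phi> (p, G p)) = 0] (mod q)"
    using turn.IH[OF G] by (simp add: cong_diff_iff_cong_0)
  finally show ?case by (simp add: sum_subtractf cong_diff_iff_cong_0)
qed simp

end


section \<open>Corner orientations modulo 3\<close>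

definition corner_rotation :: "vec \<Rightarrow> vec \<Rightarrow> vec \<Rightarrow> int" where
  "corner_rotation p e d = (if d = e then 0 else if dot p (cross e d) < 0 then 1 else 2)"

lemma corner_rotation_rot_cw [simp]:
  "corner_rotation (rot_cw X p) (rot_cw X e) (rot_cw X d) = corner_rotation p e d"
  by (simp add: corner_rotation_def)

lemma normal_dot_pos:
  assumes "d \<in> range normal" "dot (x, y, z) d > 0"
  shows "x \<noteq> 0 \<and> d = (sgn x, 0, 0) \<or> y \<noteq> 0 \<and> d = (0, sgn y, 0) \<or> z \<noteq> 0 \<and> d = (0, 0, sgn z)"
  using assms unfolding range_normal by auto

lemma corner_directions:
  assumes "n \<ge> 3" "p \<in> corners n"
  obtains a b c where "p = (a * (int n - 1), b * (int n - 1), c * (int n - 1))"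
    "a \<in> {1, -1}" "b \<in> {1, -1}" "c \<in> {1, -1}"
    "\<And>d. (p, d) \<in> facelets n \<longleftrightarrow> d \<in> {(a, 0, 0), (0, b, 0), (0, 0, c)}"
proof -
  define m where "m = int n - 1"
  have m: "m > 0" using assms(1) by (simp add: m_def)
  obtain x y z where p: "p = (x, y, z)" by (cases p)
  have xyz: "x \<in> {m, - m}" "y \<in> {m, - m}" "z \<in> {m, - m}"
    using assms(2) by (auto simp: p corners_def Let_def m_def)
  have "p = (sgn x * m, sgn y * m, sgn z * m)" "sgn x \<in> {1, -1}" "sgn y \<in> {1, -1}" "sgn z \<in> {1, -1}"
    using xyz m by (auto simp: p)
  moreover have "(p, d) \<in> facelets n \<longleftrightarrow> d \<in> {(sgn x, 0, 0), (0, sgn y, 0), (0, 0, sgn z)}" for d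
  proof -
    have "(p, d) \<in> facelets n \<longleftrightarrow> d \<in> range normal \<and> dot p d = m"
      using corner_facelets_iff[OF assms] by (simp add: m_def)
    also have "\<dots> \<longleftrightarrow> d \<in> {(sgn x, 0, 0), (0, sgn y, 0), (0, 0, sgn z)}"
    proof
      assume "d \<in> range normal \<and> dot p d = m"
      then show "d \<in> {(sgn x, 0, 0), (0, sgn y, 0), (0, 0, sgn z)}"
        using normal_dot_pos[of d x y z] m p by auto
    next
      have "sgn x * x = m" "sgn y * y = m" "sgn z * z = m" using xyz m by auto
      moreover have "(sgn x, 0, 0) \<in> range normal" "(0, sgn y, 0) \<in> range normal"
        "(0, 0, sgn z) \<in> range normal"
        using xyz m by (auto simp: range_normal)
      moreover assume "d \<in> {(sgn x, 0, 0), (0, sgn y, 0), (0, 0, sgn z)}"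
      ultimately show "d \<in> range normal \<and> dot p d = m" 
        by (elim insertE emptyE; simp only: p dot.simps) (simp_all add: mult.commute)
    qed
    finally show ?thesis .
  qed
  ultimately show thesis using that unfolding m_def by blast
qed

text \<open>The sign of \<open>a * b * c\<close> is the handedness of the corner: \<open>t\<close>
  is the cost of each cyclic step from the first axis to the second, to the third and back, and
  \<open>3 - t\<close> that of a reverse step.\<close>

lemma corner_rotation_values:
  fixes a b c m :: int
  assumes "m > 0" "a \<in> {1, -1}" "b \<in> {1, -1}" "c \<in> {1, -1}"
  defines "r \<equiv> corner_rotation (a * m, b * m, c * m)"
    and "t \<equiv> (if a * b * c < 0 then 1 else 2)"
  shows "r (a, 0, 0) (0, b, 0) = t" "r (0, b, 0) (0, 0, c) = t" "r (0, 0, c) (a, 0, 0) = t"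
    "r (0, b, 0) (a, 0, 0) = 3 - t" "r (0, 0, c) (0, b, 0) = 3 - t" "r (a, 0, 0) (0, 0, c) = 3 - t"
  unfolding r_def t_def corner_rotation_def using assms(1-4) by auto

text \<open>Thirds of a turn about the diagonal add up. Besides trivial cases this is
  \<open>t + t = 3 - t\<close> modulo 3, or steps that cancel.\<close>

lemma corner_rotation_trans:
  assumes "n \<ge> 3" "p \<in> corners n" "(p, d) \<in> facelets n" "(p, e) \<in> facelets n" "(p, f) \<in> facelets n"
  shows "[corner_rotation p d e + corner_rotation p e f = corner_rotation p d f] (mod 3)"
proof -
  obtain a b c where p: "p = (a * (int n - 1), b * (int n - 1), c * (int n - 1))"
    and abc: "a \<in> {1, -1}" "b \<in> {1, -1}" "c \<in> {1, -1}"
    and dirs: "\<And>d. (p, d) \<in> facelets n \<longleftrightarrow> d \<in> {(a, 0, 0), (0, b, 0), (0, 0, c)}"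
    using corner_directions assms(1,2) by metis
  have "int n - 1 > 0" using assms(1) by simp
  note rotations = corner_rotation_values[OF this abc, folded p]
  have self: "corner_rotation p v v = 0" for v by (simp add: corner_rotation_def)
  have "d = (a, 0, 0) \<or> d = (0, b, 0) \<or> d = (0, 0, c)" "e = (a, 0, 0) \<or> e = (0, b, 0) \<or> e = (0, 0, c)"
    "f = (a, 0, 0) \<or> f = (0, b, 0) \<or> f = (0, 0, c)"
    using assms(3-5) dirs by blast+
  then show ?thesis
    by (elim disjE) (simp_all only: rotations self, simp_all add: cong_def)
qed

definition white_direction :: "nat \<Rightarrow> face \<Rightarrow> vec \<Rightarrow> vec" where
  "white_direction n W p = (THE e. (p, e) \<in> facelets n \<and> white_yellow W (p, e))"

text \<open>Steps from the white or yellow facelet of the same position. It is applied both to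
  facelets, where it yields orientations, and to stickers, where it vanishes exactly on white and
  yellow ones.\<close>

definition corner_potential :: "nat \<Rightarrow> face \<Rightarrow> facelet \<Rightarrow> int" where
  "corner_potential n W f = corner_rotation (fst f) (white_direction n W (fst f)) (snd f)"

lemma white_direction_iff:
  assumes "n \<ge> 3" "p \<in> corners n"
  shows "(p, e) \<in> facelets n \<and> white_yellow W (p, e) \<longleftrightarrow> e = white_direction n W p"
proof -
  obtain a b c where p: "p = (a * (int n - 1), b * (int n - 1), c * (int n - 1))"
    and abc: "a \<in> {1, -1}" "b \<in> {1, -1}" "c \<in> {1, -1}"
    and dirs: "\<And>d. (p, d) \<in> facelets n \<longleftrightarrow> d \<in> {(a, 0, 0), (0, b, 0), (0, 0, c)}"
    using corner_directions assms by metis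
  define e where "e = (if W \<in> {Right, Left} then (a, 0, 0)
    else if W \<in> {Up, Down} then (0, b, 0) else (0, 0, c))"
  define D where "D = {(a, 0, 0), (0, b, 0), (0, 0, c)}"
  have "e \<in> D" by (simp add: e_def D_def)
  moreover have "\<forall>d \<in> D. white_yellow W (p, d) \<longleftrightarrow> d = e"
  proof -
    have "a = 1 \<or> a = -1" "b = 1 \<or> b = -1" "c = 1 \<or> c = -1" "a \<noteq> 0" "b \<noteq> 0" "c \<noteq> 0"
      using abc by auto
    then show ?thesis by (cases W) (simp_all add: D_def e_def white_yellow_def disj_commute)
  qed
  ultimately have "\<And>d. (p, d) \<in> facelets n \<and> white_yellow W (p, d) \<longleftrightarrow> d = e"
    unfolding dirs D_def[symmetric] by blast
  then show ?thesis
    unfolding white_direction_def by (metis (no_types, lifting) the_equality)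
qed

text \<open>The reference direction cancels, and what is left is built from \<open>dot\<close> and
  \<open>cross\<close> alone, hence rotation-invariant.\<close>

lemma corner_potential_diff:
  assumes "n \<ge> 3" "f \<in> facelets n" "g \<in> facelets n" "fst f \<in> corners n" "fst g = fst f"
  shows "[corner_potential n W f - corner_potential n W g =
    corner_rotation (fst f) (snd g) (snd f)] (mod 3)"
proof -
  have "[corner_rotation (fst f) (white_direction n W (fst f)) (snd g) +
      corner_rotation (fst f) (snd g) (snd f) =
      corner_rotation (fst f) (white_direction n W (fst f)) (snd f)] (mod 3)"
  proof (rule corner_rotation_trans[OF assms(1,4)])
    show "(fst f, white_direction n W (fst f)) \<in> facelets n"
      using white_direction_iff[OF assms(1,4)] by blast
    show "(fst f, snd g) \<in> facelets n" "(fst f, snd f) \<in> facelets n"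
      using assms(2,3,5) by (metis prod.collapse)+
  qed
  then show ?thesis
    using assms(5)
    by (simp add: corner_potential_def cong_iff_dvd_diff dvd_diff_commute algebra_simps)
qed

lemma corner_potential_eq_0_iff:
  assumes "n \<ge> 3" "f \<in> facelets n" "fst f \<in> corners n"
  shows "[corner_potential n W f = 0] (mod 3) \<longleftrightarrow> white_yellow W f"
proof -
  have "[corner_potential n W f = 0] (mod 3) \<longleftrightarrow> snd f = white_direction n W (fst f)"
    by (simp add: corner_potential_def corner_rotation_def cong_def)
  then show ?thesis
    using white_direction_iff[OF assms(1,3), of "snd f" W] assms(2) by simp
qed

text \<open>A turned slice has positive coordinate towards \<open>X\<close>, and \<open>n-1\<close>
  is the only positive value allowed to \<open>p\<close>.\<close>

lemma slice_extreme_facelet: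
  assumes "1 \<le> k" "k \<le> n div 2" "odd n" "p \<in> slice n X k"
    and "p \<in> {int n - 1, 0, 1 - int n} \<times> {int n - 1, 0, 1 - int n} \<times> {int n - 1, 0, 1 - int n}"
  shows "dot p (normal X) = int n - 1"
proof -
  have "dot p (normal X) > 0" using assms(1-4) by (auto simp: slice_def elim: oddE)
  moreover have "int n - 1 \<ge> 0" using odd_pos[OF assms(3)] by simp
  ultimately show ?thesis using assms(5) by (cases X) auto
qed

lemma corner_slice_facelet:
  assumes "n \<ge> 3" "odd n" "1 \<le> k" "k \<le> n div 2" "p \<in> corners n" "p \<in> slice n X k"
  shows "(p, normal X) \<in> facelets n"
proof -
  have "dot p (normal X) = int n - 1"
    by (rule slice_extreme_facelet) (use assms in \<open>auto simp: corners_def Let_def\<close>)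
  then show ?thesis using assms corner_facelets_iff by blast
qed

lemma corner_potential_rot_facelet:
  assumes "n \<ge> 3" "f \<in> facelets n" "g \<in> facelets n" "fst f \<in> corners n" "fst g = fst f"
  shows "[corner_potential n W (rot_facelet X f) - corner_potential n W (rot_facelet X g) =
    corner_potential n W f - corner_potential n W g] (mod 3)"
proof -
  have "[corner_potential n W (rot_facelet X f) - corner_potential n W (rot_facelet X g) =
      corner_rotation (fst f) (snd g) (snd f)] (mod 3)"
    using corner_potential_diff[of n "rot_facelet X f" "rot_facelet X g" W] assms
    by (simp add: rot_facelet_in_facelets rot_cw_in_corners)
  then show ?thesis
    using corner_potential_diff[OF assms] cong_sym cong_trans by blast
qed

lemma exists_white_yellow_sticker:
  assumes "n \<ge> 3" "valid_config n s" "p \<in> corners n"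
  shows "\<exists>d. (p, d) \<in> facelets n \<and> white_yellow W (s (p, d))"
  using assms(2,3)
proof (induction arbitrary: p rule: valid_config_turn_induct)
  case solved
  then show ?case using white_direction_iff[OF assms(1)] by fastforce
next
  case (turn s X k)
  let ?t = "turn n X k" and ?q = "position_turn n X k p"
  have "?q \<in> corners n" using turn.prems by (simp add: position_turn_def rot_cw_in_corners)
  then obtain d where d: "(?q, d) \<in> facelets n" "white_yellow W (s (?q, d))"
    using turn.IH by blast
  \<comment> \<open>The third power serves as the inverse: \<open>f\<close> is the facelet that the
    turn sends to \<open>(?q, d)\<close>.\<close>
  define f where "f = ?t (?t (?t (?q, d)))"
  have f: "f \<in> facelets n" "?t f = (?q, d)"
    using d(1) by (simp_all add: f_def turn_in_facelets turn_turn_turn_turn)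
  have "fst f = p"
    using d(1) by (simp add: f_def fst_turn turn_in_facelets) (simp add: position_turn_def)
  then have "(p, snd f) \<in> facelets n" "white_yellow W ((s \<circ> ?t) (p, snd f))"
    using f d(2) by auto
  then show ?case by blast
qed

text \<open>The selection \<open>F\<close> follows the white or yellow stickers. Their potentials
  vanish, while the facelets carrying them have the orientations as potentials; conservation equates
  the two totals.\<close>

lemma sum_corner_orientation:
  assumes "n \<ge> 3" "odd n" "valid_config n s"
  shows "[(\<Sum>p \<in> corners n. corner_orientation n W s p) = 0] (mod 3)"
proof -
  let ?\<phi> = "corner_potential n W"
  define F where "F p = (THE d. (p, d) \<in> facelets n \<and> white_yellow W (s (p, d)))" for p
  have F: "(p, F p) \<in> facelets n \<and> white_yellow W (s (p, F p))" if p: "p \<in> corners n" for p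
  proof -
    \<comment> \<open>Two such stickers would both have potential 0, so the rotation between their
      facelets is 0 modulo 3, and its value is at most 2.\<close>
    have "d = e" if "(p, d) \<in> facelets n" "white_yellow W (s (p, d))"
      "(p, e) \<in> facelets n" "white_yellow W (s (p, e))" for d e
    proof -
      have "[?\<phi> (s (p, d)) = 0] (mod 3)" "[?\<phi> (s (p, e)) = 0] (mod 3)"
        using that p valid_config_in_facelets[OF assms(3)] corner_potential_eq_0_iff[OF assms(1)]
          valid_config_position[OF assms(3) position_orbit_corners[OF assms(1)]] by auto
      then have "[?\<phi> (s (p, d)) - ?\<phi> (s (p, e)) = 0] (mod 3)"
        using cong_diff by fastforce
      moreover have "[?\<phi> (s (p, d)) - ?\<phi> (s (p, e)) = ?\<phi> (p, d) - ?\<phi> (p, e)] (mod 3)"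
        by (rule valid_config_potential_diff[OF position_orbit_corners[OF assms(1)]
              corner_slice_facelet[OF assms(1,2)] corner_potential_rot_facelet[OF assms(1)] assms(3)])
          (use that p in auto)
      moreover have "[?\<phi> (p, d) - ?\<phi> (p, e) = corner_rotation p e d] (mod 3)"
        using corner_potential_diff[of n "(p, d)" "(p, e)" W] assms(1) that p by simp
      ultimately have "[corner_rotation p e d = 0] (mod 3)"
        by (meson cong_sym cong_trans)
      then show ?thesis by (simp add: corner_rotation_def cong_def split: if_splits)
    qed
    then have "\<exists>!d. (p, d) \<in> facelets n \<and> white_yellow W (s (p, d))"
      using exists_white_yellow_sticker[OF assms(1,3) p] by blast
    then show ?thesis unfolding F_def by (rule theI')
  qed
  have "[(\<Sum>p\<in>corners n. ?\<phi> (s (p, F p))) = (\<Sum>p\<in>corners n. ?\<phi> (p, F p))] (mod 3)"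
    by (rule valid_config_potential_sum[OF position_orbit_corners[OF assms(1)]
          corner_slice_facelet[OF assms(1,2)] corner_potential_rot_facelet[OF assms(1)] assms(3)])
      (use F in auto)
  moreover have "[(\<Sum>p\<in>corners n. ?\<phi> (s (p, F p))) = (\<Sum>p\<in>corners n. 0)] (mod 3)"
    using F valid_config_in_facelets[OF assms(3)] corner_potential_eq_0_iff[OF assms(1)]
      valid_config_position[OF assms(3) position_orbit_corners[OF assms(1)]]
    by (intro cong_sum) auto
  moreover have "?\<phi> (p, F p) = int (corner_orientation n W s p)" for p
    by (simp add: corner_potential_def corner_rotation_def corner_orientation_def F_def
        white_direction_def Let_def)
  ultimately have "[(\<Sum>p\<in>corners n. int (corner_orientation n W s p)) = 0] (mod 3)"
    by (simp add: cong_def)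
  then show ?thesis
    by (metis cong_int_iff of_nat_0 of_nat_numeral of_nat_sum)
qed

section \<open>Single edge orientations modulo 2\<close>

lemma single_edge_facelets_iff:
  assumes "n \<ge> 3" "p \<in> single_edges n"
  shows "(p, d) \<in> facelets n \<longleftrightarrow> d \<in> range normal \<and> dot p d = int n - 1"
  using assms by (intro edge_facelets_iff[of "(n + 1) div 2"]) (auto simp: single_edges_def)

text \<open>One coordinate is zero, so no facelet points along that axis; along each of the others
  only the outward direction is possible.\<close>

lemma single_edge_two_facelets:
  assumes "n \<ge> 3" "odd n" "p \<in> single_edges n"
    and "(p, a) \<in> facelets n" "(p, b) \<in> facelets n" "(p, c) \<in> facelets n" "a \<noteq> b"
  shows "c = a \<or> c = b"
proof -
  define m where "m = int n - 1"
  have m: "m > 0" using assms(1) by (simp add: m_def)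
  have "p \<in> edge_positions m 0" using assms(2,3) single_edges_eq by (simp add: m_def)
  moreover obtain x y z where p: "p = (x, y, z)" by (cases p)
  ultimately have "x = 0 \<or> y = 0 \<or> z = 0"
    by (auto simp: edge_positions_def)
  moreover have "x \<noteq> 0 \<and> d = (sgn x, 0, 0) \<or> y \<noteq> 0 \<and> d = (0, sgn y, 0) \<or> z \<noteq> 0 \<and> d = (0, 0, sgn z)"
    if "(p, d) \<in> facelets n" for d
    using that assms(1,3) m p normal_dot_pos[of d x y z]
    by (simp only: single_edge_facelets_iff m_def)
  ultimately show ?thesis using assms(4-7) by metis
qed

text \<open>Dually to the corners, the selection is fixed on the reference facelets: these have
  potential 0, and the stickers on them have the orientations as potentials.\<close>

lemma sum_single_edge_orientation:
  assumes "n \<ge> 3" "odd n" "single_edge_reference n Ref" "valid_config n s"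
  shows "[(\<Sum>p \<in> single_edges n. single_edge_orientation Ref s p) = 0] (mod 2)"
proof -
  define \<phi> :: "facelet \<Rightarrow> int" where "\<phi> f = (if f \<in> Ref then 0 else 1)" for f
  define F where "F p = snd (THE f. f \<in> Ref \<and> fst f = p)" for p
  have ref: "(p, F p) \<in> Ref" "\<And>d. (p, d) \<in> Ref \<Longrightarrow> d = F p" "(p, F p) \<in> facelets n"
    if "p \<in> single_edges n" for p
  proof -
    have ex: "\<exists>!f. f \<in> Ref \<and> fst f = p" using that assms(3) by (simp add: single_edge_reference_def)
    then have the: "(THE f. f \<in> Ref \<and> fst f = p) \<in> Ref \<and> fst (THE f. f \<in> Ref \<and> fst f = p) = p"
      by (rule theI')
    have "(p, F p) = (THE f. f \<in> Ref \<and> fst f = p)"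
      unfolding F_def using the by (intro prod_eqI) simp_all
    then show R: "(p, F p) \<in> Ref" using the by simp
    show "d = F p" if "(p, d) \<in> Ref" for d
      using ex R that by (metis (no_types) fst_eqD snd_eqD)
    show "(p, F p) \<in> facelets n" using R assms(3) by (auto simp: single_edge_reference_def)
  qed
  \<comment> \<open>Of two distinct facelets of a single edge exactly one is in \<open>Ref\<close>.
    Modulo 2 the difference thus depends only on whether \<open>f = g\<close>, which rotations
    preserve.\<close>
  have diff: "[\<phi> f - \<phi> g = (if f = g then 0 else 1)] (mod 2)"
    if "f \<in> facelets n" "g \<in> facelets n" "fst f \<in> single_edges n" "fst g = fst f" for f g
  proof -
    from that(4) obtain p a b where fg: "f = (p, a)" "g = (p, b)" by (metis prod.collapse)
    have p: "p \<in> single_edges n" using that(3) fg by simp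
    have "F p = a \<or> F p = b" if "a \<noteq> b"
      using single_edge_two_facelets[OF assms(1,2) p _ _ ref(3)[OF p] that] \<open>f \<in> _\<close> \<open>g \<in> _\<close> fg
      by blast
    moreover have "(p, d) \<in> Ref \<longleftrightarrow> d = F p" for d using ref[OF p] by blast
    ultimately show ?thesis by (auto simp: \<phi>_def fg cong_def)
  qed
  have potential: "[\<phi> (rot_facelet X f) - \<phi> (rot_facelet X g) = \<phi> f - \<phi> g] (mod 2)"
    if "f \<in> facelets n" "g \<in> facelets n" "fst f \<in> single_edges n" "fst g = fst f" for X f g
  proof -
    have *: "[\<phi> (rot_facelet X f) - \<phi> (rot_facelet X g) =
        (if rot_facelet X f = rot_facelet X g then 0 else 1)] (mod 2)"
      by (rule diff) (use that in \<open>simp_all add: rot_facelet_in_facelets single_edges_def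
          rot_cw_in_edge_cubies\<close>)
    have inj: "rot_facelet X f = rot_facelet X g \<longleftrightarrow> f = g"
      by (metis rot_facelet_rot_facelet_rot_facelet_rot_facelet)
    show ?thesis using cong_trans[OF *[unfolded inj] cong_sym[OF diff[OF that]]] .
  qed
  have face: "(p, normal X) \<in> facelets n"
    if "1 \<le> k" "k \<le> n div 2" "p \<in> single_edges n" "p \<in> slice n X k" for X k p
  proof -
    have "dot p (normal X) = int n - 1"
      by (rule slice_extreme_facelet[OF that(1,2) assms(2) that(4)])
        (use that(3) in \<open>auto simp: single_edges_eq[OF assms(2)] edge_positions_def\<close>)
    then show ?thesis using assms(1) that single_edge_facelets_iff by blast
  qed
  have "[(\<Sum>p\<in>single_edges n. \<phi> (s (p, F p))) = (\<Sum>p\<in>single_edges n. \<phi> (p, F p))] (mod 2)"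
    by (rule valid_config_potential_sum[OF position_orbit_single_edges[OF assms(1)] face potential
          assms(4)]) (use ref in auto)
  moreover have "(\<Sum>p\<in>single_edges n. \<phi> (p, F p)) = 0"
    using ref by (intro sum.neutral) (auto simp: \<phi>_def)
  moreover have "(\<Sum>p\<in>single_edges n. \<phi> (s (p, F p))) =
      (\<Sum>p\<in>single_edges n. int (single_edge_orientation Ref s p))"
  proof (rule sum.cong)
    fix p assume p: "p \<in> single_edges n"
    have "(\<exists>f\<in>Ref. fst f = p \<and> s f \<in> Ref) \<longleftrightarrow> s (p, F p) \<in> Ref"
      using ref[OF p] by (metis fst_conv prod.collapse)
    then show "\<phi> (s (p, F p)) = int (single_edge_orientation Ref s p)"
      by (simp add: \<phi>_def single_edge_orientation_def edge_orientation_def)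
  qed simp
  ultimately have "[(\<Sum>p\<in>single_edges n. int (single_edge_orientation Ref s p)) = 0] (mod 2)"
    by simp
  then show ?thesis
    by (metis cong_int_iff of_nat_0 of_nat_numeral of_nat_sum)
qed

section \<open>Coupled edge orientations\<close>

lemma rot_facelet_left_handed:
  assumes "f \<in> left_handed_facelets n i"
  shows "rot_facelet X f \<in> left_handed_facelets n i"
proof -
  obtain p Y Z where f: "f = (p, normal Y)" "p \<in> edge_cubies n i" "(p, normal Y) \<in> facelets n"
    "(p, normal Z) \<in> facelets n" "dot p (cross (normal Z) (normal Y)) < 0"
    using assms by (auto simp: left_handed_facelets_def)
  obtain Y' Z' where Y': "rot_cw X (normal Y) = normal Y'" and Z': "rot_cw X (normal Z) = normal Z'"
    using rot_cw_range_normal by (metis rangeE rangeI)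
  have "(rot_cw X p, normal Y') \<in> facelets n" "(rot_cw X p, normal Z') \<in> facelets n"
    using f(3,4) rot_facelet_in_facelets[of _ n X] Y' Z' rot_facelet_simps(1) by metis+
  moreover have "dot (rot_cw X p) (cross (normal Z') (normal Y')) < 0"
    using f(5) by (simp flip: Y' Z')
  ultimately show ?thesis
    using f(1,2) Y' rot_cw_in_edge_cubies unfolding left_handed_facelets_def by fastforce
qed

lemma valid_config_left_handed:
  "valid_config n s \<Longrightarrow> f \<in> left_handed_facelets n i \<Longrightarrow> s f \<in> left_handed_facelets n i"
  by (induction arbitrary: f rule: valid_config_turn_induct)
    (auto simp: turn_eq rot_facelet_left_handed)

text \<open>The pair \<open>(X, Y)\<close> naming the cubie is ordered so that its offset along
  \<open>cross (normal X) (normal Y)\<close> is the negative number \<open>u\<close>; this makes the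
  facelet on \<open>Y\<close> left-handed.\<close>

lemma exists_left_handed_facelet:
  assumes "i \<in> {2..(n - 1) div 2}" "p \<in> edge_cubies n i"
  obtains d where "(p, d) \<in> left_handed_facelets n i"
proof -
  define m u where "m = int n - 1" and "u = 2 * int i - int n - 1"
  have u: "u < 0" using assms(1) by (auto simp: u_def)
  obtain X Y where XY: "dot (normal X) (normal Y) = 0"
    and p: "p = scale m (normal X + normal Y) + scale u (cross (normal X) (normal Y))"
    using assms(2) by (auto simp: edge_cubies_def m_def u_def)
  have "dot p (normal X) = m" "dot p (normal Y) = m" "dot p (cross (normal X) (normal Y)) = u"
    unfolding p using XY by (cases X; cases Y; simp)+
  moreover from calculation have "(p, normal X) \<in> facelets n" "(p, normal Y) \<in> facelets n"
    using assms by (auto simp: edge_facelets_iff[of i] m_def)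
  ultimately have "(p, normal Y) \<in> left_handed_facelets n i"
    using assms(2) u unfolding left_handed_facelets_def by blast
  then show thesis by (rule that)
qed

lemma coupled_edge_orientation_eq_0:
  assumes "i \<in> {2..(n - 1) div 2}" "valid_config n s" "p \<in> edge_cubies n i"
  shows "coupled_edge_orientation n i s p = 0"
proof -
  obtain d where "(p, d) \<in> left_handed_facelets n i"
    using exists_left_handed_facelet assms(1,3) .
  then have "\<exists>f \<in> left_handed_facelets n i. fst f = p \<and> s f \<in> left_handed_facelets n i"
    using valid_config_left_handed[OF assms(2)] by (metis fst_conv)
  then show ?thesis by (simp add: coupled_edge_orientation_def edge_orientation_def)
qed

section \<open>Comparison of the signs\<close>

lemma sign_valid_config:
  assumes "n \<ge> 3" "odd n" "valid_config n s"
  shows "sign (single_edge_perm n s) = sign (corner_perm n s)"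
    and "i \<in> {2..(n - 1) div 2} \<Longrightarrow> sign (center_corner_perm n i s) = sign (corner_perm n s)"
    and "i \<in> {2..(n - 1) div 2} \<Longrightarrow> j \<in> {2..(n + 1) div 2} - {i} \<Longrightarrow>
      sign (center_edge_perm n i j s) = sign (corner_perm n s) * sign (coupled_edge_perm n i s) *
        (if j = (n + 1) div 2 then 1 else sign (coupled_edge_perm n j s))"
proof -
  have id: "sign (corner_perm n id) = 1" "sign (single_edge_perm n id) = 1"
    using position_orbit_corners[OF assms(1)] position_orbit_single_edges[OF assms(1)]
    by (simp_all only: corner_perm_def single_edge_perm_def position_orbit_id sign_id)
  show "sign (single_edge_perm n s) = sign (corner_perm n s)"
    using assms(3)
  proof (induction rule: valid_config_turn_induct)
    case (turn s X k)
    then show ?case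
      by (simp only: sign_single_edge_perm_turn[OF assms(1,2)] sign_corner_perm_turn[OF assms(1)])
  qed (simp only: id)
  show "sign (center_corner_perm n i s) = sign (corner_perm n s)" if i: "i \<in> {2..(n - 1) div 2}"
    using assms(3)
  proof (induction rule: valid_config_turn_induct)
    case (turn s X k)
    have "i \<in> {2..(n + 1) div 2}" using i by auto
    then have "sign (center_corner_perm n i (s \<circ> turn n X k)) =
        sign (center_corner_perm n i s) * (if k = 1 then -1 else 1)"
      unfolding center_corner_perm_eq using turn i sign_center_edge_perm_turn[of i n i s k X] by auto
    then show ?case
      using turn by (simp only: sign_corner_perm_turn[OF assms(1)])
  qed (simp only: id center_corner_perm_eq sign_center_edge_perm_id)
  show "sign (center_edge_perm n i j s) = sign (corner_perm n s) * sign (coupled_edge_perm n i s) *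
        (if j = (n + 1) div 2 then 1 else sign (coupled_edge_perm n j s))"
    if i: "i \<in> {2..(n - 1) div 2}" and j: "j \<in> {2..(n + 1) div 2} - {i}"
    using assms(3)
  proof (induction rule: valid_config_turn_induct)
    case solved
    \<comment> \<open>The middle index is included so that both branches of the conditional reduce
      to 1.\<close>
    have "sign (coupled_edge_perm n t id) = 1" if "t \<in> {2..(n + 1) div 2}" for t
    proof -
      have "position_orbit n (edge_cubies n t)"
        using that assms(1) by (intro position_orbit_edge_cubies) auto
      then show ?thesis by (simp only: coupled_edge_perm_def position_orbit_id sign_id)
    qed
    moreover have "i \<in> {2..(n + 1) div 2}" using i by auto
    ultimately have "sign (coupled_edge_perm n i id) = 1" "sign (coupled_edge_perm n j id) = 1"
      using j by blast+
    then show ?case by (simp only: id sign_center_edge_perm_id if_cancel mult_1)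
  next
    case (turn s X k)
    \<comment> \<open>As \<open>i \<noteq> j\<close>, the case of eight moved facelets does not
      arise. The three sign-changing values of \<open>k\<close> are matched by the corners and the
      two coupled edge orbits.\<close>
    have C: "sign (center_edge_perm n i j (s \<circ> turn n X k)) = sign (center_edge_perm n i j s) *
        (if k \<in> {1, i, j} then -1 else 1)"
      using sign_center_edge_perm_turn[of i n j s k X] turn i j by auto
    have E: "sign (coupled_edge_perm n i (s \<circ> turn n X k)) =
        sign (coupled_edge_perm n i s) * (if k = i then -1 else 1)"
      using sign_coupled_edge_perm_turn i turn by blast
    show ?case
    proof (cases "j = (n + 1) div 2")
      case True
      \<comment> \<open>The middle layer is never turned, which is why its factor is 1.\<close>
      then have "k \<noteq> j" using turn assms(2) by (auto elim!: oddE)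
      then show ?thesis
        unfolding C E sign_corner_perm_turn[OF assms(1) turn.hyps] using turn.IH True i by auto
    next
      case False
      then have j': "j \<in> {2..(n - 1) div 2}" using j assms(2) by (auto elim!: oddE)
      have E': "sign (coupled_edge_perm n j (s \<circ> turn n X k)) =
          sign (coupled_edge_perm n j s) * (if k = j then -1 else 1)"
        using sign_coupled_edge_perm_turn j' turn by blast
      show ?thesis
        unfolding C E E' sign_corner_perm_turn[OF assms(1) turn.hyps]
        using turn.IH False i j j' by auto
    qed
  qed
qed

theorem theorem8:
  fixes n :: nat and s :: config and W :: face and Ref :: "facelet set"
  assumes "n \<ge> 3" and "odd n"
    and "single_edge_reference n Ref"
    and "valid_config n s"
  shows
    "(sign (corner_perm n s) = sign (single_edge_perm n s) \<and>
      (\<forall>i \<in> {2..(n - 1) div 2}. sign (single_edge_perm n s) = sign (center_corner_perm n i s))) \<and>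
     (\<forall>i \<in> {2..(n - 1) div 2}. \<forall>j \<in> {2..(n + 1) div 2} - {i}.
        sign (center_edge_perm n i j s) =
          sign (corner_perm n s) * sign (coupled_edge_perm n i s) *
          (if j = (n + 1) div 2 then 1 else sign (coupled_edge_perm n j s))) \<and>
     [(\<Sum>p \<in> corners n. corner_orientation n W s p) = 0] (mod 3) \<and>
     [(\<Sum>p \<in> single_edges n. single_edge_orientation Ref s p) = 0] (mod 2) \<and>
     (\<forall>i \<in> {2..(n - 1) div 2}. \<forall>p \<in> edge_cubies n i. coupled_edge_orientation n i s p = 0)"
  using sign_valid_config[OF assms(1,2,4)] sum_corner_orientation[OF assms(1,2,4)]
    sum_single_edge_orientation[OF assms] coupled_edge_orientation_eq_0[OF _ assms(4)]
  by (intro conjI ballI) auto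

end
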